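(* There is an infinite branch piecewise linear map whose Lyapunov spectrum has a countable infinity of inflection points.
   Context: Infinite branch piecewise linear map: given a countably infinite collection $\{X_i\}_{i=1}^\infty$ of pairwise disjoint closed sub-intervals of $[0,1]$ with lengths $|X_i|>0$, an associated infinite branch piecewise linear map is a map $T:\bigcup_{i=1}^\infty X_i\to[0,1]$ whose restriction to each $X_i$ is an affine homeomorphism onto $[0,1]$ (so $|T'|=|X_i|^{-1}$ on $X_i$). Its invariant set is $X=\{x\in[0,1]:T^n(x)\in\bigcup_{i=1}^\infty X_i\text{ for all }n\ge0\}$, and $T$ is regarded as a dynamical system $T:X\to X$. Lyapunov spectrum: for $x\in X$ let $\lambda(x)=\lim_{n\to\infty}\frac1n\log|(T^n)'(x)|$ whenever this limit exists (as a real number), and let $A$ be the set of all values taken by $\lambda$ (an interval, unbounded above). The Lyapunov spectrum is $L:A\to\mathbb{R}$, $L(\alpha)=\dim_H\{x\in X:\lambda(x)\text{ exists and equals }\alpha\}$, where $\dim_H$ is Hausdorff dimension. An inflection point of $L$ is a point $\alpha$ in the interior of $A$ with $L''(\alpha)=0$. *)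

theory Defs
  imports "HOL-Analysis.Analysis"
begin

section \<open>Hausdorff dimension\<close>

text \<open>The contribution \<open>|U| ^ s\<close> of a covering set, with the usual conventions that the empty set
  contributes \<open>0\<close> and that a nonempty set contributes \<open>1\<close> when \<open>s = 0\<close> (whereas \<open>0 powr 0 = 0\<close>).\<close>

definition hausdorff_gauge :: "real \<Rightarrow> 'a::metric_space set \<Rightarrow> ennreal" where
  "hausdorff_gauge s U =
    (if U = {} then 0 else if s = 0 then 1 else ennreal (diameter U powr s))"

text \<open>Boundedness is required of the covering sets because \<open>diameter\<close> is only meaningful for
  bounded sets.\<close>

definition hausdorff_premeasure :: "real \<Rightarrow> real \<Rightarrow> 'a::metric_space set \<Rightarrow> ennreal" where
  "hausdorff_premeasure s \<delta> E =
    (INF U \<in> {U :: nat \<Rightarrow> 'a set. E \<subseteq> (\<Union>i. U i) \<and> (\<forall>i. bounded (U i) \<and> diameter (U i) \<le> \<delta>)}.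
       \<Sum>i. hausdorff_gauge s (U i))"

definition hausdorff_measure :: "real \<Rightarrow> 'a::metric_space set \<Rightarrow> ennreal" where
  "hausdorff_measure s E = (SUP \<delta> \<in> {0<..}. hausdorff_premeasure s \<delta> E)"

definition hausdorff_dim :: "'a::metric_space set \<Rightarrow> ennreal" where
  "hausdorff_dim E = (INF s \<in> {s. 0 \<le> s \<and> hausdorff_measure s E = 0}. ennreal s)"


section \<open>Infinite branch piecewise linear maps\<close>

text \<open>A partial map on \<open>\<Union>i. B i\<close> is represented by a total function \<open>T\<close>, whose values off
  \<open>\<Union>i. B i\<close> are irrelevant to all the notions below.\<close>

definition infinite_branch_pl_map :: "(nat \<Rightarrow> real set) \<Rightarrow> (real \<Rightarrow> real) \<Rightarrow> bool" where
  "infinite_branch_pl_map B T \<longleftrightarrow>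
     (\<forall>i. \<exists>a b. a < b \<and> B i = {a..b} \<and> {a..b} \<subseteq> {0..1}) \<and>
     disjoint_family B \<and>
     (\<forall>i. (\<exists>c d. \<forall>x \<in> B i. T x = c * x + d) \<and> (\<exists>g. homeomorphism (B i) {0..1} T g))"

definition invariant_set :: "(nat \<Rightarrow> real set) \<Rightarrow> (real \<Rightarrow> real) \<Rightarrow> real set" where
  "invariant_set B T = {x \<in> {0..1}. \<forall>n. (T ^^ n) x \<in> (\<Union>i. B i)}"

text \<open>The points of \<open>[0,1]\<close> that follow the same branches as \<open>x\<close> during the first \<open>n\<close> steps.
  For \<open>x\<close> in the invariant set this is a nondegenerate closed interval.\<close>

definition cylinder :: "(nat \<Rightarrow> real set) \<Rightarrow> (real \<Rightarrow> real) \<Rightarrow> nat \<Rightarrow> real \<Rightarrow> real set" where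
  "cylinder B T n x =
     {y \<in> {0..1}. \<forall>k<n. \<exists>i. (T ^^ k) x \<in> B i \<and> (T ^^ k) y \<in> B i}"

text \<open>The derivative of \<open>T ^^ n\<close> at \<open>x\<close> is that of the branch of \<open>T ^^ n\<close> through \<open>x\<close>, one-sided at
  the endpoints of its domain. Differentiating within \<open>\<Union>i. B i\<close> would not do: other branches may
  accumulate at an endpoint of \<open>B i\<close>.\<close>

definition iterate_deriv :: "(nat \<Rightarrow> real set) \<Rightarrow> (real \<Rightarrow> real) \<Rightarrow> nat \<Rightarrow> real \<Rightarrow> real" where
  "iterate_deriv B T n x = vector_derivative (T ^^ n) (at x within cylinder B T n x)"


section \<open>The Lyapunov spectrum\<close>

definition has_lyapunov_exponent ::
    "(nat \<Rightarrow> real set) \<Rightarrow> (real \<Rightarrow> real) \<Rightarrow> real \<Rightarrow> real \<Rightarrow> bool" where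
  "has_lyapunov_exponent B T x \<alpha> \<longleftrightarrow>
     (\<lambda>n. 1 / real n * ln \<bar>iterate_deriv B T n x\<bar>) \<longlonglongrightarrow> \<alpha>"

definition lyapunov_values :: "(nat \<Rightarrow> real set) \<Rightarrow> (real \<Rightarrow> real) \<Rightarrow> real set" where
  "lyapunov_values B T = {\<alpha>. \<exists>x \<in> invariant_set B T. has_lyapunov_exponent B T x \<alpha>}"

text \<open>Only the values on \<open>lyapunov_values B T\<close> are meaningful. The conversion to \<open>real\<close> loses nothing,
  as the Hausdorff dimension of a subset of the real line is at most \<open>1\<close>.\<close>

definition lyapunov_spectrum :: "(nat \<Rightarrow> real set) \<Rightarrow> (real \<Rightarrow> real) \<Rightarrow> real \<Rightarrow> real" where
  "lyapunov_spectrum B T \<alpha> =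
     enn2real (hausdorff_dim {x \<in> invariant_set B T. has_lyapunov_exponent B T x \<alpha>})"

text \<open>\<open>L''(\<alpha>) = 0\<close> includes the existence of the second derivative: \<open>L\<close> is differentiable near \<open>\<alpha>\<close>
  and \<open>L'\<close> is differentiable at \<open>\<alpha>\<close>.\<close>

definition inflection_points :: "real set \<Rightarrow> (real \<Rightarrow> real) \<Rightarrow> real set" where
  "inflection_points A L =
     {\<alpha> \<in> interior A. (\<forall>\<^sub>F x in nhds \<alpha>. L differentiable (at x)) \<and>
        (deriv L has_real_derivative 0) (at \<alpha>)}"

end

theory Submission
  imports Defs "HOL-Probability.Infinite_Product_Measure" "HOL-Probability.Probability_Mass_Function"
    "HOL-Complex_Analysis.Conformal_Mappings"
begin

text \<open>Let branch \<open>i\<close> have length \<open>exp (- \<lambda>\<^sub>i)\<close>. The thermodynamic formalism attaches to the lengths the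
pressure \<open>P t = ln (\<Sum>i. exp (- t * \<lambda>\<^sub>i))\<close>. If the series converges for every \<open>t > 0\<close>, then \<open>- P'\<close> is a
decreasing bijection of \<open>{0<..}\<close> onto \<open>{\<lambda>\<^sub>0<..}\<close>, where \<open>exp (- \<lambda>\<^sub>0)\<close> is the largest length, and the
Lyapunov spectrum is a Legendre transform: \<open>L \<alpha> = t + P t / \<alpha>\<close> with \<open>\<alpha> = - P' t\<close>. Differentiating
gives \<open>L' \<alpha> = - P t / \<alpha>\<^sup>2\<close>, and \<open>L'' \<alpha> = 0\<close> says exactly that \<open>2 * P t * P'' t = (P' t)\<^sup>2\<close>, that is, where
\<open>P\<close> is positive, that \<open>sqrt P\<close> has vanishing second derivative at \<open>t\<close>.

For the dimension formula (\<open>hausdorff_dim_level_set\<close>) both bounds come from the Bernoulli measure with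
weights \<open>exp (- t * \<lambda>\<^sub>i - P t)\<close>. A point with exponent \<open>\<alpha>\<close> lies in cylinders of length about
\<open>exp (- n * \<alpha>)\<close> and of mass about \<open>exp (- n * (t * \<alpha> + P t))\<close>, so covering by cylinders bounds the
dimension above. From below, almost every point has exponent \<open>\<alpha>\<close> by a Chernoff bound, and the mass
distribution principle applies. It is made easy by the choice of positions: each branch sits in the
middle third of a slot three times as long. A set that meets two children of a cylinder is then at
least as long as each child it meets, while its mass is at most that of the parent cylinder. At almost
every point the mass of the parent is bounded by the power of the length of the child that is wanted,
so the mass is controlled by the diameter (\<open>mass_of_set\<close>).

The inflection points are countable because \<open>P\<close> extends holomorphically to a neighbourhood of the
positive axis, so that the zeros of \<open>2 * P * P'' - P'\<^sup>2\<close> are isolated. They are infinitely many if \<open>sqrt P\<close>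
is neither convex nor concave on any interval \<open>{0<..<d}\<close>. Concavity fails because \<open>P\<close> is unbounded near
\<open>0\<close>. Convexity fails for a lacunary choice of the lengths: with about \<open>exp n\<^sub>k\<close> branches of the same
exponent \<open>R\<^sub>k\<close>, where \<open>n\<^sub>k\<close> and \<open>R\<^sub>k / n\<^sub>k\<close> grow geometrically, one block dominates the pressure on a long
range of \<open>t\<close>, where \<open>P t\<close> is close to the affine function \<open>n\<^sub>k - R\<^sub>k * t\<close>; and the square root of a
nonconstant affine function is strictly concave.\<close>

section \<open>A piecewise linear map with separated branches\<close>

lemma power_le_exp:
  fixes x :: real assumes "0 \<le> x" shows "x ^ k \<le> fact k * exp x"
proof -
  have "(\<Sum>n\<in>{k}. x ^ n /\<^sub>R fact n) \<le> (\<Sum>n. x ^ n /\<^sub>R fact n)"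
    by (rule sum_le_suminf) (use exp_converges[of x] assms in \<open>auto simp: sums_iff\<close>)
  also have "\<dots> = exp x" using exp_converges[of x] by (simp add: sums_iff)
  finally show ?thesis by (simp add: field_simps)
qed

text \<open>The numbers \<open>lam i\<close> are the logarithmic expansion rates of the branches. The bound \<open>1 / 3\<close> on the total
length leaves room for gaps as long as the adjacent branches.\<close>
locale gap_system =
  fixes lam :: "nat \<Rightarrow> real"
  assumes lam_min: "lam 0 \<le> lam i"
    and lam_pos: "0 < lam 0"
    and summable_exp: "0 < t \<Longrightarrow> summable (\<lambda>i. exp (- t * lam i))"
    and sum_len: "(\<Sum>i. exp (- lam i)) \<le> 1 / 3"
begin

abbreviation branch_len :: "nat \<Rightarrow> real" where "branch_len i \<equiv> exp (- lam i)"

text \<open>Branch \<open>i\<close> is the middle third of the \<open>i\<close>-th of a row of consecutive slots of lengths \<open>3 * branch_len j\<close>.\<close>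
definition left_end :: "nat \<Rightarrow> real" where "left_end i = 3 * (\<Sum>j<i. branch_len j) + branch_len i"

definition branch :: "nat \<Rightarrow> real set" where "branch i = {left_end i..left_end i + branch_len i}"

definition branch_index :: "real \<Rightarrow> nat" where "branch_index x = (SOME i. x \<in> branch i)"

definition branch_map :: "real \<Rightarrow> real" where "branch_map x = (x - left_end (branch_index x)) * exp (lam (branch_index x))"

lemma lam_gt0: "0 < lam i"
  using lam_pos lam_min[of i] by linarith

lemma left_end_nonneg: "0 \<le> left_end i"
  unfolding left_end_def by (simp add: sum_nonneg)

lemma branch_le1: "left_end i + branch_len i \<le> 1"
proof -
  have s: "summable branch_len" using summable_exp[of 1] by simp
  have "(\<Sum>j<Suc i. branch_len j) \<le> suminf branch_len" by (rule sum_le_suminf[OF s]) auto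
  then have "3 * (\<Sum>j<Suc i. branch_len j) \<le> 1" using sum_len by linarith
  then show ?thesis unfolding left_end_def using exp_gt_zero[of "- lam i"] by (simp add: algebra_simps del: exp_gt_zero)
qed

lemma branch_subset: "branch i \<subseteq> {0..1}"
  unfolding branch_def using left_end_nonneg[of i] branch_le1[of i] by auto

lemma branch_separated:
  assumes "i < j" "x \<in> branch i" "y \<in> branch j"
  shows "branch_len i + branch_len j \<le> y - x"
proof -
  have "(\<Sum>k<Suc i. branch_len k) \<le> (\<Sum>k<j. branch_len k)"
    by (rule sum_mono2) (use assms in auto)
  then show ?thesis using assms(2,3) unfolding branch_def left_end_def by auto
qed

lemma branch_gap:
  assumes "i \<noteq> j" "x \<in> branch i" "y \<in> branch j"
  shows "branch_len i \<le> \<bar>x - y\<bar>"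
proof (cases "i < j")
  case True
  then show ?thesis using branch_separated[OF True assms(2,3)] exp_gt_zero[of "- lam j"] by linarith
next
  case False
  then have "j < i" using assms by auto
  from branch_separated[OF this assms(3,2)] show ?thesis using exp_gt_zero[of "- lam j"] by linarith
qed

lemma branch_inj: "x \<in> branch i \<Longrightarrow> x \<in> branch j \<Longrightarrow> i = j"
  using branch_gap[of i j x x] exp_gt_zero[of "- lam i"] by fastforce

lemma branch_index_eq: "x \<in> branch i \<Longrightarrow> branch_index x = i"
  unfolding branch_index_def by (rule some_equality) (auto dest: branch_inj)

lemma branch_map_eq: "x \<in> branch i \<Longrightarrow> branch_map x = (x - left_end i) * exp (lam i)"
  unfolding branch_map_def by (simp add: branch_index_eq)

lemma branch_map_inverse_branch:
  assumes "v \<in> {0..1}"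
  shows "left_end i + branch_len i * v \<in> branch i" "branch_map (left_end i + branch_len i * v) = v"
proof -
  show *: "left_end i + branch_len i * v \<in> branch i"
    using assms unfolding branch_def by (auto intro: mult_left_le)
  show "branch_map (left_end i + branch_len i * v) = v"
    unfolding branch_map_eq[OF *] by (simp add: exp_minus field_simps)
qed

lemma inverse_branch_branch_map:
  assumes "x \<in> branch i" shows "branch_map x \<in> {0..1}" "left_end i + branch_len i * branch_map x = x"
proof -
  have "0 \<le> x - left_end i" "x - left_end i \<le> branch_len i" using assms by (auto simp: branch_def)
  then show "branch_map x \<in> {0..1}" unfolding branch_map_eq[OF assms]
    by (auto simp: exp_minus field_simps)
  show "left_end i + branch_len i * branch_map x = x" unfolding branch_map_eq[OF assms] by (simp add: exp_minus field_simps)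
qed

lemma infinite_branch_pl_map_branch_map: "infinite_branch_pl_map branch branch_map"
  unfolding infinite_branch_pl_map_def
proof (intro conjI allI)
  fix i
  show "\<exists>a b. a < b \<and> branch i = {a..b} \<and> {a..b} \<subseteq> {0..1}"
    using branch_subset[of i] by (intro exI[of _ "left_end i"] exI[of _ "left_end i + branch_len i"]) (auto simp: branch_def)
  have *: "branch_map x = exp (lam i) * x + (- left_end i * exp (lam i))" if "x \<in> branch i" for x
    unfolding branch_map_eq[OF that] by (simp add: algebra_simps)
  then show "\<exists>c d. \<forall>x\<in>branch i. branch_map x = c * x + d" by blast
  have "homeomorphism (branch i) {0..1} branch_map (\<lambda>v. left_end i + branch_len i * v)"
  proof (rule homeomorphismI)
    show "continuous_on (branch i) branch_map"
      by (subst continuous_on_cong[OF refl *]) (auto intro!: continuous_intros)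
    show "continuous_on {0..1} (\<lambda>v. left_end i + branch_len i * v)" by (intro continuous_intros)
  qed (use branch_map_inverse_branch inverse_branch_branch_map in auto)
  then show "\<exists>g. homeomorphism (branch i) {0..1} branch_map g" by blast
next
  show "disjoint_family branch"
    unfolding disjoint_family_on_def using branch_inj by blast
qed

text \<open>The interval of points whose first \<open>n\<close> steps use the branches \<open>\<omega> 0, \<dots>, \<omega> (n - 1)\<close>.\<close>
definition follows :: "nat \<Rightarrow> (nat \<Rightarrow> nat) \<Rightarrow> real set" where
  "follows n \<omega> = {x \<in> {0..1}. \<forall>k<n. (branch_map ^^ k) x \<in> branch (\<omega> k)}"

text \<open>The logarithm of the slope of the \<open>n\<close>-th iterate along the itinerary \<open>\<omega>\<close>.\<close>
definition birkhoff_sum :: "(nat \<Rightarrow> nat) \<Rightarrow> nat \<Rightarrow> real" where "birkhoff_sum \<omega> n = (\<Sum>k<n. lam (\<omega> k))"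

definition itinerary :: "real \<Rightarrow> nat \<Rightarrow> nat" where "itinerary x k = branch_index ((branch_map ^^ k) x)"

lemma follows_expand:
  assumes "x \<in> follows n \<omega>" "y \<in> follows n \<omega>"
  shows "(branch_map ^^ n) x - (branch_map ^^ n) y = exp (birkhoff_sum \<omega> n) * (x - y)"
  using assms
proof (induction n)
  case (Suc n)
  then have b: "(branch_map ^^ n) x \<in> branch (\<omega> n)" "(branch_map ^^ n) y \<in> branch (\<omega> n)"
    and f: "x \<in> follows n \<omega>" "y \<in> follows n \<omega>" by (auto simp: follows_def)
  have "(branch_map ^^ Suc n) x - (branch_map ^^ Suc n) y = ((branch_map ^^ n) x - (branch_map ^^ n) y) * exp (lam (\<omega> n))"
    by (simp add: branch_map_eq[OF b(1)] branch_map_eq[OF b(2)] algebra_simps)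
  then show ?case by (simp add: Suc.IH[OF f] birkhoff_sum_def exp_add)
qed (simp add: birkhoff_sum_def)

lemma follows_range: "x \<in> follows n \<omega> \<Longrightarrow> (branch_map ^^ n) x \<in> {0..1}"
  by (cases n) (auto simp: follows_def dest!: inverse_branch_branch_map(1))

lemma follows_surj:
  "v \<in> {0..1} \<Longrightarrow> \<exists>y\<in>follows n \<omega>. (branch_map ^^ n) y = v"
proof (induction n arbitrary: v)
  case 0 then show ?case by (auto simp: follows_def)
next
  case (Suc n)
  let ?v = "left_end (\<omega> n) + branch_len (\<omega> n) * v"
  have v: "?v \<in> branch (\<omega> n)" "branch_map ?v = v" using branch_map_inverse_branch[OF Suc.prems] by auto
  then have "?v \<in> {0..1}" using branch_subset by blast
  from Suc.IH[OF this] obtain y where "y \<in> follows n \<omega>" "(branch_map ^^ n) y = ?v" by blast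
  with v show ?case by (intro bexI[of _ y]) (auto simp: follows_def less_Suc_eq)
qed

lemma follows_diameter:
  "bounded (follows n \<omega>) \<and> diameter (follows n \<omega>) \<le> exp (- birkhoff_sum \<omega> n)"
proof
  show "bounded (follows n \<omega>)"
    by (rule bounded_subset[of "{0..1}"]) (auto simp: follows_def)
  have "dist x y \<le> exp (- birkhoff_sum \<omega> n)" if "x \<in> follows n \<omega>" "y \<in> follows n \<omega>" for x y
  proof -
    have "exp (birkhoff_sum \<omega> n) * \<bar>x - y\<bar> = \<bar>(branch_map ^^ n) x - (branch_map ^^ n) y\<bar>"
      using follows_expand[OF that] by (simp add: abs_mult)
    also have "\<dots> \<le> 1" using follows_range[OF that(1)] follows_range[OF that(2)] by auto
    finally show ?thesis by (simp add: dist_real_def exp_minus field_simps)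
  qed
  then show "diameter (follows n \<omega>) \<le> exp (- birkhoff_sum \<omega> n)"
    by (intro diameter_le) (auto simp: dist_norm)
qed

lemma invariant_set_follows: "x \<in> invariant_set branch branch_map \<Longrightarrow> x \<in> follows n (itinerary x)"
  unfolding invariant_set_def follows_def itinerary_def using branch_index_eq by fastforce

lemma itinerary_unique:
  "(branch_map ^^ k) x \<in> branch (\<omega> k) \<Longrightarrow> itinerary x k = \<omega> k"
  unfolding itinerary_def by (simp add: branch_index_eq)

lemma cylinder_eq_follows:
  assumes "x \<in> invariant_set branch branch_map"
  shows "cylinder branch branch_map n x = follows n (itinerary x)"
proof -
  have "(branch_map ^^ k) x \<in> branch i \<longleftrightarrow> i = itinerary x k" for k i
    using invariant_set_follows[OF assms, of "Suc k"] by (auto simp: follows_def dest: branch_inj)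
  then show ?thesis unfolding cylinder_def follows_def by auto
qed

text \<open>On the cylinder of \<open>x\<close> the \<open>n\<close>-th iterate is affine, and it maps the cylinder onto \<open>{0..1}\<close>. Hence \<open>x\<close> is
an accumulation point of its cylinder, and the derivative within the cylinder is determined.\<close>
lemma iterate_deriv_eq:
  assumes x: "x \<in> invariant_set branch branch_map"
  shows "iterate_deriv branch branch_map n x = exp (birkhoff_sum (itinerary x) n)"
  unfolding iterate_deriv_def cylinder_eq_follows[OF x]
proof (rule vector_derivative_within)
  let ?F = "follows n (itinerary x)" and ?b = "exp (birkhoff_sum (itinerary x) n)"
  have xF: "x \<in> ?F" by (rule invariant_set_follows[OF x])
  show "((branch_map ^^ n) has_vector_derivative ?b) (at x within ?F)"
  proof (rule has_vector_derivative_transform[OF xF])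
    show "\<And>y. y \<in> ?F \<Longrightarrow> (branch_map ^^ n) y = (branch_map ^^ n) x + (y - x) * ?b"
      using follows_expand[OF _ xF] by (simp add: algebra_simps)
    show "((\<lambda>y. (branch_map ^^ n) x + (y - x) * ?b) has_vector_derivative ?b) (at x within ?F)"
      unfolding has_real_derivative_iff_has_vector_derivative[symmetric]
      by (auto intro!: derivative_eq_intros)
  qed
  have "x islimpt ?F"
    unfolding islimpt_approachable
  proof (intro allI impI)
    fix e :: real assume "e > 0"
    define u where "u = (branch_map ^^ n) x"
    have u: "u \<in> {0..1}" unfolding u_def by (rule follows_range[OF xF])
    obtain v where v: "v \<in> {0..1}" "v \<noteq> u" "\<bar>v - u\<bar> < e * ?b"
    proof (cases "u < 1")
      case True
      then show ?thesis using that[of "min 1 (u + e * ?b / 2)"] u \<open>e > 0\<close> by (auto simp: min_def)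
    next
      case False
      then show ?thesis using that[of "max 0 (u - e * ?b / 2)"] u \<open>e > 0\<close> by (auto simp: max_def)
    qed
    obtain y where y: "y \<in> ?F" "(branch_map ^^ n) y = v" using follows_surj[OF v(1)] by blast
    have "?b * \<bar>y - x\<bar> = \<bar>v - u\<bar>" using follows_expand[OF y(1) xF] y(2) by (simp add: u_def abs_mult)
    then have "?b * \<bar>y - x\<bar> < ?b * e" using v(3) by (simp add: mult.commute)
    then have "dist y x < e" by (simp add: dist_real_def)
    moreover have "y \<noteq> x" using v(2) y(2) u_def by auto
    ultimately show "\<exists>x'\<in>?F. x' \<noteq> x \<and> dist x' x < e" using y(1) by blast
  qed
  then show "at x within ?F \<noteq> bot" by (simp add: trivial_limit_within)
qed

lemma has_lyapunov_exponent_iff: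
  assumes "x \<in> invariant_set branch branch_map"
  shows "has_lyapunov_exponent branch branch_map x \<alpha> \<longleftrightarrow> (\<lambda>n. birkhoff_sum (itinerary x) n / real n) \<longlonglongrightarrow> \<alpha>"
  unfolding has_lyapunov_exponent_def iterate_deriv_eq[OF assms] by simp

text \<open>The sum of the left ends met along the itinerary \<open>\<omega>\<close>, each scaled by the length of the cylinder in
which it is met, is the point common to all the cylinders.\<close>
definition coded_point :: "(nat \<Rightarrow> nat) \<Rightarrow> real" where
  "coded_point \<omega> = (\<Sum>k. exp (- birkhoff_sum \<omega> k) * left_end (\<omega> k))"

lemma birkhoff_sum_lower: "real n * lam 0 \<le> birkhoff_sum \<omega> n"
  unfolding birkhoff_sum_def using sum_bounded_below[of "{..<n}" "lam 0" "\<lambda>k. lam (\<omega> k)"] lam_min by simp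

text \<open>The partial sum is the left end of a cylinder of length \<open>exp (- birkhoff_sum \<omega> n)\<close> within \<open>{0..1}\<close>.\<close>
lemma coded_point_partial: "(\<Sum>k<n. exp (- birkhoff_sum \<omega> k) * left_end (\<omega> k)) + exp (- birkhoff_sum \<omega> n) \<le> 1"
proof (induction n)
  case (Suc n)
  have "exp (- birkhoff_sum \<omega> n) * (left_end (\<omega> n) + branch_len (\<omega> n)) \<le> exp (- birkhoff_sum \<omega> n) * 1"
    by (intro mult_left_mono branch_le1) simp
  moreover have "exp (- birkhoff_sum \<omega> (Suc n)) = exp (- birkhoff_sum \<omega> n) * branch_len (\<omega> n)"
    by (simp add: birkhoff_sum_def exp_add[symmetric])
  ultimately show ?case using Suc by (simp add: algebra_simps)
qed (simp add: birkhoff_sum_def)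

lemma coded_point_summable: "summable (\<lambda>k. exp (- birkhoff_sum \<omega> k) * left_end (\<omega> k))"
proof (rule summableI_nonneg_bounded[where x = 1])
  show "0 \<le> exp (- birkhoff_sum \<omega> n) * left_end (\<omega> n)" for n using left_end_nonneg by simp
  show "(\<Sum>k<n. exp (- birkhoff_sum \<omega> k) * left_end (\<omega> k)) \<le> 1" for n
    using coded_point_partial[of \<omega> n] exp_gt_zero[of "- birkhoff_sum \<omega> n"] by linarith
qed

lemma coded_point_range: "coded_point \<omega> \<in> {0..1}"
proof -
  have "(\<Sum>k<n. exp (- birkhoff_sum \<omega> k) * left_end (\<omega> k)) \<le> 1" for n
    using coded_point_partial[of \<omega> n] exp_gt_zero[of "- birkhoff_sum \<omega> n"] by linarith
  then have "coded_point \<omega> \<le> 1" unfolding coded_point_def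
    by (intro suminf_le_const[OF coded_point_summable]) auto
  moreover have "0 \<le> coded_point \<omega>" unfolding coded_point_def
    by (intro suminf_nonneg[OF coded_point_summable]) (use left_end_nonneg in auto)
  ultimately show ?thesis by simp
qed

lemma coded_point_shift: "coded_point \<omega> = left_end (\<omega> 0) + branch_len (\<omega> 0) * coded_point (\<lambda>k. \<omega> (Suc k))"
proof -
  have b: "birkhoff_sum \<omega> (Suc k) = lam (\<omega> 0) + birkhoff_sum (\<lambda>k. \<omega> (Suc k)) k" for k
    unfolding birkhoff_sum_def by (rule sum.lessThan_Suc_shift)
  have "coded_point \<omega> = (\<Sum>k. exp (- birkhoff_sum \<omega> (Suc k)) * left_end (\<omega> (Suc k))) + exp (- birkhoff_sum \<omega> 0) * left_end (\<omega> 0)"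
    unfolding coded_point_def using suminf_split_head[OF coded_point_summable[of \<omega>]] by simp
  also have "(\<Sum>k. exp (- birkhoff_sum \<omega> (Suc k)) * left_end (\<omega> (Suc k)))
      = (\<Sum>k. branch_len (\<omega> 0) * (exp (- birkhoff_sum (\<lambda>k. \<omega> (Suc k)) k) * left_end (\<omega> (Suc k))))"
    by (simp add: b exp_diff exp_minus field_simps)
  also have "\<dots> = branch_len (\<omega> 0) * coded_point (\<lambda>k. \<omega> (Suc k))"
    unfolding coded_point_def by (rule suminf_mult[OF coded_point_summable])
  finally show ?thesis by (simp add: birkhoff_sum_def)
qed

lemma branch_map_coded_point: "coded_point \<omega> \<in> branch (\<omega> 0)" "branch_map (coded_point \<omega>) = coded_point (\<lambda>k. \<omega> (Suc k))"
  using branch_map_inverse_branch[OF coded_point_range] by (subst coded_point_shift; simp)+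

lemma branch_map_iterate_coded_point: "(branch_map ^^ n) (coded_point \<omega>) = coded_point (\<lambda>k. \<omega> (n + k))"
  by (induction n) (simp_all add: branch_map_coded_point)

lemma coded_point_branch: "(branch_map ^^ n) (coded_point \<omega>) \<in> branch (\<omega> n)"
  unfolding branch_map_iterate_coded_point using branch_map_coded_point(1)[of "\<lambda>k. \<omega> (n + k)"] by simp

lemma coded_point_invariant: "coded_point \<omega> \<in> invariant_set branch branch_map"
  unfolding invariant_set_def using coded_point_range coded_point_branch by blast

lemma coded_point_follows: "coded_point \<omega> \<in> follows n \<omega>"
  unfolding follows_def using coded_point_range coded_point_branch by blast

lemma itinerary_coded_point: "itinerary (coded_point \<omega>) = \<omega>"
  by (rule ext) (rule itinerary_unique[OF coded_point_branch])

text \<open>The \<open>n\<close>-th iterate stretches the distance by \<open>exp (birkhoff_sum \<omega> n)\<close> and puts the points in distinct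
branches, which the gaps keep at a distance of at least the length of either.\<close>
lemma coded_point_separated:
  assumes "\<And>k. k < n \<Longrightarrow> \<omega>' k = \<omega> k" "\<omega>' n \<noteq> \<omega> n"
  shows "exp (- birkhoff_sum \<omega> (Suc n)) \<le> \<bar>coded_point \<omega> - coded_point \<omega>'\<bar>"
proof -
  have f: "coded_point \<omega> \<in> follows n \<omega>" "coded_point \<omega>' \<in> follows n \<omega>"
    using coded_point_follows[of \<omega>' n] coded_point_follows[of \<omega> n] assms(1) by (auto simp: follows_def)
  have "branch_len (\<omega> n) \<le> \<bar>(branch_map ^^ n) (coded_point \<omega>) - (branch_map ^^ n) (coded_point \<omega>')\<bar>"
    by (rule branch_gap[OF _ coded_point_branch coded_point_branch]) (use assms in auto)
  also have "\<dots> = exp (birkhoff_sum \<omega> n) * \<bar>coded_point \<omega> - coded_point \<omega>'\<bar>"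
    by (simp add: follows_expand[OF f] abs_mult)
  finally have "exp (- birkhoff_sum \<omega> n) * branch_len (\<omega> n) \<le> \<bar>coded_point \<omega> - coded_point \<omega>'\<bar>"
    by (simp add: exp_minus field_simps)
  then show ?thesis by (simp add: birkhoff_sum_def exp_add[symmetric])
qed

end

section \<open>Pressure and its Legendre transform\<close>

context gap_system
begin

text \<open>The \<open>k\<close>-th derivative of the partition function \<open>\<Sum>i. exp (- lam i * z)\<close>. The type is left open because
the differential calculus is done on the real line, whereas the countability of the inflection points
uses the holomorphic extension to the right half-plane.\<close>
definition dirichlet :: "nat \<Rightarrow> 'a::{real_normed_field,banach} \<Rightarrow> 'a" where
  "dirichlet k z = (\<Sum>i. of_real (- lam i) ^ k * exp (of_real (- lam i) * z))"

lemma summable_power_exp: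
  assumes "0 < t" shows "summable (\<lambda>i. lam i ^ k * exp (- t * lam i))"
proof (rule summable_comparison_test')
  show "summable (\<lambda>i. fact k / (t / 2) ^ k * exp (- (t / 2) * lam i))"
    by (intro summable_mult summable_exp) (use assms in simp)
  fix i
  have "(t / 2 * lam i) ^ k \<le> fact k * exp (t / 2 * lam i)"
    by (rule power_le_exp) (use assms lam_gt0[of i] in simp)
  then have "lam i ^ k \<le> fact k / (t / 2) ^ k * exp (t / 2 * lam i)"
    using assms by (simp add: power_mult_distrib field_simps)
  then have "lam i ^ k * exp (- t * lam i) \<le> fact k / (t / 2) ^ k * exp (t / 2 * lam i) * exp (- t * lam i)"
    by (rule mult_right_mono) simp
  also have "\<dots> = fact k / (t / 2) ^ k * exp (- (t / 2) * lam i)"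
    by (simp add: mult_exp_exp algebra_simps)
  finally show "norm (lam i ^ k * exp (- t * lam i)) \<le> fact k / (t / 2) ^ k * exp (- (t / 2) * lam i)"
    using lam_gt0[of i] by simp
qed

text \<open>Weierstrass' test permits termwise differentiation: on \<open>S\<close> the \<open>k\<close>-th differentiated series is dominated
by \<open>\<Sum>i. lam i ^ k * exp (- d * lam i)\<close>.\<close>
lemma
  fixes z :: "'a::{real_normed_field,banach}"
  assumes S: "convex S" "open S" "z \<in> S" and d: "0 < d"
    and bound: "\<And>i w. w \<in> S \<Longrightarrow> norm (exp (of_real (- lam i) * w)) \<le> exp (- d * lam i)"
  shows dirichlet_summable_on: "summable (\<lambda>i. of_real (- lam i) ^ k * exp (of_real (- lam i) * z))"
    and dirichlet_has_derivative_on: "(dirichlet k has_field_derivative dirichlet (Suc k) z) (at z)"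
proof -
  let ?f = "\<lambda>k i (w::'a). of_real (- lam i) ^ k * exp (of_real (- lam i) * w)"
  have le: "norm (?f k i w) \<le> lam i ^ k * exp (- d * lam i)" if "w \<in> S" for k i w
    using mult_left_mono[OF bound[OF that, of i], of "lam i ^ k"] lam_gt0[of i]
    by (simp add: norm_mult norm_power)
  have sm: "summable (\<lambda>i. ?f k i z)" for k
    by (rule summable_comparison_test'[OF summable_power_exp[OF d, of k] le[OF S(3)]])
  then show "summable (\<lambda>i. ?f k i z)" .
  have "((\<lambda>w. \<Sum>i. ?f k i w) has_field_derivative (\<Sum>i. ?f (Suc k) i z)) (at z)"
  proof (rule has_field_derivative_series'(2)[where f = "?f k" and f' = "?f (Suc k)", OF S(1) _ _ S(3) sm])
    show "uniformly_convergent_on S (\<lambda>n w. \<Sum>i<n. ?f (Suc k) i w)"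
      by (rule Weierstrass_m_test'[OF le summable_power_exp[OF d]])
    show "z \<in> interior S" using S by (simp add: interior_open)
  qed (auto intro!: derivative_eq_intros simp: algebra_simps)
  then show "(dirichlet k has_field_derivative dirichlet (Suc k) z) (at z)"
    unfolding dirichlet_def[abs_def] .
qed

lemma
  fixes t :: real assumes "0 < t"
  shows dirichlet_summable: "summable (\<lambda>i. (- lam i) ^ k * exp (- lam i * t))"
    and dirichlet_has_real_derivative: "(dirichlet k has_real_derivative dirichlet (Suc k) t) (at t)"
proof -
  have S: "convex {t/2<..}" "open {t/2<..}" "t \<in> {t/2<..}" "0 < t / 2" using assms by auto
  have b: "norm (exp (of_real (- lam i) * w)) \<le> exp (- (t / 2) * lam i)" if "w \<in> {t/2<..}" for i and w :: real
    using that lam_gt0[of i] by simp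
  show "summable (\<lambda>i. (- lam i) ^ k * exp (- lam i * t))"
    using dirichlet_summable_on[OF S b, of k] by simp
  show "(dirichlet k has_real_derivative dirichlet (Suc k) t) (at t)"
    using dirichlet_has_derivative_on[OF S b] .
qed

lemma dirichlet_has_complex_derivative:
  fixes z :: complex assumes "0 < Re z"
  shows "(dirichlet k has_field_derivative dirichlet (Suc k) z) (at z)"
proof -
  have S: "convex {w. Re w > Re z / 2}" "open {w. Re w > Re z / 2}" "z \<in> {w. Re w > Re z / 2}" "0 < Re z / 2"
    using assms by (simp_all only: convex_halfspace_Re_gt open_halfspace_Re_gt) simp_all
  have b: "norm (exp (of_real (- lam i) * w)) \<le> exp (- (Re z / 2) * lam i)"
    if "w \<in> {w. Re w > Re z / 2}" for i and w :: complex
    using that lam_gt0[of i] by simp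
  show ?thesis using dirichlet_has_derivative_on[OF S b] .
qed

lemma dirichlet_of_real:
  assumes "0 < t" shows "dirichlet k (complex_of_real t) = of_real (dirichlet k t)"
proof -
  have sums: "(\<lambda>i. complex_of_real ((- lam i) ^ k * exp (- lam i * t))) sums of_real (\<Sum>i. (- lam i) ^ k * exp (- lam i * t))"
    unfolding sums_of_real_iff by (rule summable_sums[OF dirichlet_summable[OF assms]])
  have eq: "complex_of_real ((- lam i) ^ k * exp (- lam i * t)) = of_real (- lam i) ^ k * exp (of_real (- lam i) * of_real t)" for i
    by (simp flip: exp_of_real)
  have "dirichlet k (complex_of_real t) = (\<Sum>i. complex_of_real ((- lam i) ^ k * exp (- lam i * t)))"
    unfolding dirichlet_def by (intro suminf_cong eq[symmetric])
  also have "\<dots> = of_real (dirichlet k t)" using sums by (simp add: dirichlet_def sums_iff del: of_real_mult of_real_power)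
  finally show ?thesis .
qed

definition pressure :: "real \<Rightarrow> real" where "pressure t = ln (dirichlet 0 t)"

text \<open>Under the probability weights \<open>exp (- t * lam i - pressure t)\<close> the numbers \<open>lam i\<close> have this mean and
the variance defined next; they are \<open>- P'\<close> and \<open>P''\<close> for the pressure \<open>P\<close>.\<close>
definition mean_exponent :: "real \<Rightarrow> real" where "mean_exponent t = - dirichlet 1 t / dirichlet 0 t"

definition exponent_variance :: "real \<Rightarrow> real" where
  "exponent_variance t = (dirichlet 2 t * dirichlet 0 t - (dirichlet 1 t)\<^sup>2) / (dirichlet 0 t)\<^sup>2"

lemma exp_sums_dirichlet: "0 < t \<Longrightarrow> (\<lambda>i. exp (- lam i * t)) sums dirichlet 0 t"
  using summable_sums[OF dirichlet_summable[of t 0]] by (simp add: dirichlet_def)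

lemma dirichlet_ge_sum:
  assumes "0 < t" "finite I" shows "(\<Sum>i\<in>I. exp (- lam i * t)) \<le> dirichlet 0 t"
  using exp_sums_dirichlet[OF assms(1)] sum_le_suminf[of "\<lambda>i. exp (- lam i * t)" I] assms(2)
  by (simp add: sums_iff)

lemma dirichlet_pos: "0 < t \<Longrightarrow> 0 < dirichlet 0 (t::real)"
  using dirichlet_ge_sum[of t "{0}"] less_le_trans[OF exp_gt_zero] by auto

lemma exp_pressure: "0 < t \<Longrightarrow> exp (pressure t) = dirichlet 0 t"
  by (simp add: pressure_def dirichlet_pos)

lemma pressure_gt: "0 < t \<Longrightarrow> - lam i * t < pressure t"
proof -
  assume t: "0 < t"
  have "exp (- lam i * t) < exp (- lam i * t) + exp (- lam (Suc i) * t)" by simp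
  also have "\<dots> = (\<Sum>j\<in>{i, Suc i}. exp (- lam j * t))" by simp
  also have "\<dots> \<le> dirichlet 0 t" by (rule dirichlet_ge_sum[OF t]) simp
  finally show ?thesis unfolding exp_pressure[OF t, symmetric] by simp
qed

lemma pressure_has_derivative:
  assumes "0 < t" shows "(pressure has_real_derivative - mean_exponent t) (at t)"
  unfolding pressure_def[abs_def] mean_exponent_def using dirichlet_pos[OF assms]
  by (auto intro!: derivative_eq_intros dirichlet_has_real_derivative[OF assms])

lemma mean_exponent_has_derivative:
  assumes "0 < t" shows "(mean_exponent has_real_derivative - exponent_variance t) (at t)"
  unfolding mean_exponent_def[abs_def] exponent_variance_def using dirichlet_pos[OF assms]
  by (auto intro!: derivative_eq_intros dirichlet_has_real_derivative[OF assms]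
      simp: power2_eq_square numeral_2_eq_2 field_simps)

text \<open>A constant \<open>lam\<close> would make the convergent series \<open>\<Sum>i. exp (- lam i)\<close> have constant positive terms.\<close>
lemma lam_nonconst: obtains i where "lam 0 < lam i"
proof -
  have False if "\<And>i. lam i = lam 0"
  proof -
    have "(\<lambda>i. exp (- 1 * lam i)) \<longlonglongrightarrow> 0" by (rule summable_LIMSEQ_zero[OF summable_exp]) simp
    moreover have "(\<lambda>i. exp (- 1 * lam i)) = (\<lambda>i. exp (- lam 0))" using that by (simp add: fun_eq_iff)
    ultimately have "(\<lambda>i::nat. exp (- lam 0)) \<longlonglongrightarrow> 0" by metis
    then have "exp (- lam 0) = 0" by (simp only: LIMSEQ_const_iff)
    then show False by simp
  qed
  then show ?thesis using that lam_min by (metis order_le_less)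
qed

text \<open>The variance is the sum of the nonnegative terms \<open>(lam i - m)\<^sup>2 * exp (- lam i * t)\<close>, up to normalisation,
and they do not all vanish.\<close>
lemma exponent_variance_pos: assumes "0 < t" shows "0 < exponent_variance t"
proof -
  let ?D = "\<lambda>k. dirichlet k t" and ?m = "mean_exponent t"
  have s: "(\<lambda>i. (- lam i) ^ k * exp (- lam i * t)) sums ?D k" for k
    using summable_sums[OF dirichlet_summable[OF assms, of k]] by (simp add: dirichlet_def)
  have "(\<lambda>i. (- lam i) ^ 2 * exp (- lam i * t) + 2 * ?m * ((- lam i) ^ 1 * exp (- lam i * t))
      + ?m\<^sup>2 * ((- lam i) ^ 0 * exp (- lam i * t))) sums (?D 2 + 2 * ?m * ?D 1 + ?m\<^sup>2 * ?D 0)"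
    by (intro sums_add sums_mult s)
  also have "(\<lambda>i. (- lam i) ^ 2 * exp (- lam i * t) + 2 * ?m * ((- lam i) ^ 1 * exp (- lam i * t))
      + ?m\<^sup>2 * ((- lam i) ^ 0 * exp (- lam i * t))) = (\<lambda>i. (lam i - ?m)\<^sup>2 * exp (- lam i * t))"
    by (rule ext) (simp add: power2_eq_square algebra_simps)
  also have "?D 2 + 2 * ?m * ?D 1 + ?m\<^sup>2 * ?D 0 = ?D 0 * exponent_variance t"
    using dirichlet_pos[OF assms] by (simp add: mean_exponent_def exponent_variance_def power2_eq_square field_simps)
  finally have sums: "(\<lambda>i. (lam i - ?m)\<^sup>2 * exp (- lam i * t)) sums (?D 0 * exponent_variance t)" .
  obtain i where i: "lam 0 < lam i" by (rule lam_nonconst)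
  then obtain j where "lam j \<noteq> ?m" by (metis less_irrefl)
  then have "0 < (\<Sum>i. (lam i - ?m)\<^sup>2 * exp (- lam i * t))"
    by (intro suminf_pos2[where i = j] sums_summable[OF sums]) auto
  then have "0 < ?D 0 * exponent_variance t" using sums by (simp add: sums_iff)
  then show ?thesis using dirichlet_pos[OF assms] by (simp add: zero_less_mult_iff)
qed

lemma mean_exponent_gt: assumes "0 < t" shows "lam 0 < mean_exponent t"
proof -
  let ?D = "\<lambda>k. dirichlet k t"
  have s: "(\<lambda>i. (- lam i) ^ k * exp (- lam i * t)) sums ?D k" for k
    using summable_sums[OF dirichlet_summable[OF assms, of k]] by (simp add: dirichlet_def)
  have "(\<lambda>i. - 1 * ((- lam i) ^ 1 * exp (- lam i * t)) + - lam 0 * ((- lam i) ^ 0 * exp (- lam i * t)))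
      sums (- 1 * ?D 1 + - lam 0 * ?D 0)"
    by (intro sums_add sums_mult s)
  also have "(\<lambda>i. - 1 * ((- lam i) ^ 1 * exp (- lam i * t)) + - lam 0 * ((- lam i) ^ 0 * exp (- lam i * t)))
      = (\<lambda>i. (lam i - lam 0) * exp (- lam i * t))"
    by (rule ext) (simp add: algebra_simps)
  finally have sums: "(\<lambda>i. (lam i - lam 0) * exp (- lam i * t)) sums (- 1 * ?D 1 + - lam 0 * ?D 0)" .
  obtain i where i: "lam 0 < lam i" by (rule lam_nonconst)
  then have "0 < (\<Sum>i. (lam i - lam 0) * exp (- lam i * t))"
    by (intro suminf_pos2[where i = i] sums_summable[OF sums]) (auto simp: lam_min)
  then have "0 < - ?D 1 - lam 0 * ?D 0" using sums by (simp add: sums_iff)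
  then show ?thesis using dirichlet_pos[OF assms] by (simp add: mean_exponent_def field_simps)
qed

lemma mean_exponent_strict_antimono: "0 < s \<Longrightarrow> s < t \<Longrightarrow> mean_exponent t < mean_exponent s"
  by (rule DERIV_neg_imp_decreasing[where f = mean_exponent])
     (metis mean_exponent_has_derivative exponent_variance_pos less_le_trans neg_less_0_iff_less)+

text \<open>As \<open>t\<close> tends to \<open>0\<close>, the first \<open>N\<close> terms of the partition function alone contribute about \<open>N\<close>.\<close>
lemma pressure_at_0: "\<exists>d>0. \<forall>t\<in>{0<..<d}. K < pressure t"
proof -
  obtain N :: nat where N: "exp K < real N" using reals_Archimedean2 by blast
  have "((\<lambda>t. \<Sum>i<N. exp (- lam i * t)) \<longlongrightarrow> (\<Sum>i<N. exp (- lam i * 0))) (at_right 0)"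
    by (intro tendsto_intros)
  then have "\<forall>\<^sub>F t in at_right 0. exp K < (\<Sum>i<N. exp (- lam i * t))"
    using N by (intro order_tendstoD) auto
  then obtain d where d: "d > 0" "\<And>t. 0 < t \<Longrightarrow> t < d \<Longrightarrow> exp K < (\<Sum>i<N. exp (- lam i * t))"
    unfolding eventually_at_right_field by auto
  have "K < pressure t" if "0 < t" "t < d" for t
  proof -
    have "exp K < dirichlet 0 t" using d(2)[OF that] dirichlet_ge_sum[OF that(1), of "{..<N}"] by auto
    then have "exp K < exp (pressure t)" using exp_pressure[OF that(1)] by simp
    then show ?thesis by simp
  qed
  with d(1) show ?thesis by auto
qed

text \<open>By the intermediate value theorem it is enough that \<open>- P'\<close> takes values on both sides of \<open>a\<close>. If
\<open>- P' \<ge> a\<close> everywhere, then \<open>P\<close> would eventually drop below its lower bound \<open>- lam 0 * t\<close>; if \<open>- P' \<le> a\<close>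
everywhere, then \<open>P\<close> would stay bounded near \<open>0\<close>.\<close>
lemma mean_exponent_surj: assumes "lam 0 < a" obtains t where "0 < t" "mean_exponent t = a"
proof -
  have mvt: "\<exists>z>s. z < t \<and> pressure t - pressure s = (t - s) * - mean_exponent z" if "0 < s" "s < t" for s t
    by (rule MVT2[OF that(2)]) (use that pressure_has_derivative in auto)
  have "\<exists>t>0. mean_exponent t < a"
  proof (rule ccontr)
    assume "\<not> (\<exists>t>0. mean_exponent t < a)"
    then have ge: "\<And>t. 0 < t \<Longrightarrow> a \<le> mean_exponent t" by force
    define t where "t = 1 + (\<bar>pressure 1\<bar> + lam 0 + 1) / (a - lam 0)"
    have t1: "1 < t" unfolding t_def using assms lam_pos by simp
    obtain z where z: "1 < z" "z < t" "pressure t - pressure 1 = (t - 1) * - mean_exponent z"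
      using mvt[of 1 t] t1 by auto
    have "(t - 1) * a \<le> (t - 1) * mean_exponent z" using t1 z ge[of z] by simp
    moreover have "- lam 0 * t \<le> pressure t" by (rule less_imp_le[OF pressure_gt]) (use t1 in simp)
    moreover have "(t - 1) * (a - lam 0) = \<bar>pressure 1\<bar> + lam 0 + 1" using assms by (simp add: t_def)
    ultimately show False using z(3) by (simp add: algebra_simps)
  qed
  then obtain v where v: "0 < v" "mean_exponent v < a" by blast
  have "\<exists>t>0. a < mean_exponent t"
  proof (rule ccontr)
    assume "\<not> (\<exists>t>0. a < mean_exponent t)"
    then have le: "\<And>t. 0 < t \<Longrightarrow> mean_exponent t \<le> a" by force
    obtain d where d: "d > 0" "\<forall>t\<in>{0<..<d}. pressure 1 + a < pressure t" using pressure_at_0 by blast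
    define t where "t = min d 1 / 2"
    have t: "0 < t" "t < d" "t < 1" using d by (auto simp: t_def)
    obtain z where z: "t < z" "z < 1" "pressure 1 - pressure t = (1 - t) * - mean_exponent z"
      using mvt[of t 1] t by auto
    have "(1 - t) * mean_exponent z \<le> (1 - t) * a" using t z le[of z] by simp
    also have "\<dots> \<le> 1 * a" using t assms lam_pos by (intro mult_right_mono) auto
    finally show False using z(3) d(2)[rule_format, of t] t by simp
  qed
  then obtain u where u: "0 < u" "a < mean_exponent u" by blast
  have uv: "u < v" using mean_exponent_strict_antimono[of v u] u v by (cases u v rule: linorder_cases) auto
  have "continuous_on {u..v} mean_exponent"
    by (intro DERIV_atLeastAtMost_imp_continuous_on) (use u mean_exponent_has_derivative less_le_trans in blast)
  then obtain t where "u \<le> t" "t \<le> v" "mean_exponent t = a" using IVT2'[of mean_exponent v a u] u v uv by auto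
  then show ?thesis using that[of t] u by linarith
qed

text \<open>The parameter \<open>t\<close> whose equilibrium state has Lyapunov exponent \<open>a\<close>.\<close>
definition temperature :: "real \<Rightarrow> real" where "temperature a = (THE t. 0 < t \<and> mean_exponent t = a)"

lemma mean_exponent_inj: "0 < s \<Longrightarrow> 0 < t \<Longrightarrow> mean_exponent s = mean_exponent t \<Longrightarrow> s = t"
  using mean_exponent_strict_antimono[of s t] mean_exponent_strict_antimono[of t s] by (cases s t rule: linorder_cases) auto

lemma temperature_mean: "0 < t \<Longrightarrow> temperature (mean_exponent t) = t"
  unfolding temperature_def by (rule the_equality) (auto intro: mean_exponent_inj)

lemma mean_exponent_temperature: assumes "lam 0 < a" shows "0 < temperature a" "mean_exponent (temperature a) = a"
  using mean_exponent_surj[OF assms] temperature_mean by metis+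

lemma temperature_has_derivative:
  assumes "lam 0 < a" shows "(temperature has_real_derivative - 1 / exponent_variance (temperature a)) (at a)"
proof -
  have t: "0 < temperature a" "mean_exponent (temperature a) = a" using mean_exponent_temperature[OF assms] by auto
  have "isCont temperature a"
  proof -
    have "isCont temperature (mean_exponent (temperature a))"
    proof (rule isCont_inverse_function[where d = "temperature a / 2" and f = mean_exponent and x = "temperature a"])
      show "0 < temperature a / 2" using t by simp
      fix z assume "\<bar>z - temperature a\<bar> \<le> temperature a / 2"
      then have z: "0 < z" using t(1) by (simp add: abs_if split: if_splits)
      show "temperature (mean_exponent z) = z" by (rule temperature_mean[OF z])
      show "isCont mean_exponent z" using mean_exponent_has_derivative[OF z] DERIV_isCont by blast
    qed
    then show ?thesis by (simp add: t)
  qed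
  then have "(temperature has_real_derivative inverse (- exponent_variance (temperature a))) (at a)"
    by (intro has_field_derivative_inverse_basic[where f = mean_exponent and t = "{lam 0<..}"])
       (use assms mean_exponent_has_derivative[OF t(1)] exponent_variance_pos[OF t(1)] mean_exponent_temperature in auto)
  then show ?thesis by (simp add: field_simps)
qed

definition dim_formula :: "real \<Rightarrow> real" where "dim_formula a = temperature a + pressure (temperature a) / a"

text \<open>This is \<open>2 * P * P'' - P'\<^sup>2\<close>, which is \<open>4 * P powr (3/2)\<close> times the second derivative of \<open>sqrt P\<close> where
\<open>P\<close> is positive.\<close>
definition inflection_fun :: "real \<Rightarrow> real" where "inflection_fun t = 2 * pressure t * exponent_variance t - (mean_exponent t)\<^sup>2"

text \<open>The derivative of the inner function \<open>temperature\<close> cancels: \<open>t\<close> is a critical point of \<open>t + P t / a\<close> for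
fixed \<open>a\<close>.\<close>
lemma dim_formula_has_derivative:
  assumes "lam 0 < a" shows "(dim_formula has_real_derivative - pressure (temperature a) / a\<^sup>2) (at a)"
proof -
  have t: "0 < temperature a" "mean_exponent (temperature a) = a" "a \<noteq> 0" using mean_exponent_temperature[OF assms] assms lam_pos by auto
  note d = temperature_has_derivative[OF assms]
  have p: "((\<lambda>a. pressure (temperature a)) has_real_derivative - a * (- 1 / exponent_variance (temperature a))) (at a)"
    using DERIV_chain2[OF pressure_has_derivative[OF t(1)] d] t by simp
  show ?thesis unfolding dim_formula_def[abs_def] using t exponent_variance_pos[OF t(1)]
    by (auto intro!: derivative_eq_intros p d simp: field_simps power2_eq_square)
qed

lemma dim_formula_has_second_derivative:
  assumes "lam 0 < a"
  shows "((\<lambda>a. - pressure (temperature a) / a\<^sup>2) has_real_derivative inflection_fun (temperature a) / (a ^ 3 * exponent_variance (temperature a))) (at a)"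
proof -
  have t: "0 < temperature a" "mean_exponent (temperature a) = a" "a \<noteq> 0" using mean_exponent_temperature[OF assms] assms lam_pos by auto
  note d = temperature_has_derivative[OF assms]
  have p: "((\<lambda>a. pressure (temperature a)) has_real_derivative - a * (- 1 / exponent_variance (temperature a))) (at a)"
    using DERIV_chain2[OF pressure_has_derivative[OF t(1)] d] t by simp
  show ?thesis using t exponent_variance_pos[OF t(1)]
    by (auto intro!: derivative_eq_intros p simp: inflection_fun_def)
       (simp add: field_simps power2_eq_square power3_eq_cube power4_eq_xxxx)
qed

lemma inflection_points_eq:
  assumes A: "interior A = {lam 0<..}" and L: "\<And>a. lam 0 < a \<Longrightarrow> L a = dim_formula a"
  shows "inflection_points A L = mean_exponent ` {t. 0 < t \<and> inflection_fun t = 0}"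
proof -
  have ev: "\<forall>\<^sub>F x in nhds a. lam 0 < x" if "lam 0 < a" for a
    using that by (intro eventually_nhds_in_open[of "{lam 0<..}", simplified])
  have dL: "(L has_real_derivative - pressure (temperature a) / a\<^sup>2) (at a)" if "lam 0 < a" for a
    using DERIV_cong_ev[of a a L dim_formula, OF refl eventually_mono[OF ev[OF that] L] refl] dim_formula_has_derivative[OF that] by blast
  have d2L: "(deriv L has_real_derivative inflection_fun (temperature a) / (a ^ 3 * exponent_variance (temperature a))) (at a)" if "lam 0 < a" for a
  proof -
    have *: "\<forall>\<^sub>F x in nhds a. deriv L x = - pressure (temperature x) / x\<^sup>2"
      using ev[OF that] by eventually_elim (intro DERIV_imp_deriv dL)
    then show ?thesis using DERIV_cong_ev[OF refl * refl] dim_formula_has_second_derivative[OF that] by blast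
  qed
  have "a \<in> inflection_points A L \<longleftrightarrow> lam 0 < a \<and> inflection_fun (temperature a) = 0" for a
  proof (cases "lam 0 < a")
    case True
    have "\<forall>\<^sub>F x in nhds a. L differentiable at x"
      using ev[OF True] by eventually_elim (use dL real_differentiable_def in blast)
    moreover have "(deriv L has_real_derivative 0) (at a) \<longleftrightarrow> inflection_fun (temperature a) = 0"
    proof -
      have "a ^ 3 * exponent_variance (temperature a) \<noteq> 0" using True lam_pos exponent_variance_pos[OF mean_exponent_temperature(1)[OF True]] by auto
      then show ?thesis using d2L[OF True] DERIV_unique by fastforce
    qed
    ultimately show ?thesis unfolding inflection_points_def A using True by auto
  qed (simp add: inflection_points_def A)
  then show ?thesis using mean_exponent_temperature temperature_mean mean_exponent_gt by (auto simp: image_iff) metis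
qed

lemma inflection_fun_continuous: "0 < t \<Longrightarrow> isCont inflection_fun t"
proof -
  assume t: "0 < t"
  have "isCont (dirichlet k) t" for k using dirichlet_has_real_derivative[OF t] DERIV_isCont by blast
  then show ?thesis unfolding inflection_fun_def[abs_def] pressure_def[abs_def] exponent_variance_def[abs_def] mean_exponent_def[abs_def]
    using dirichlet_pos[OF t] by (intro continuous_intros) auto
qed

text \<open>Up to the factor \<open>(dirichlet 0 t)\<^sup>2\<close>, the function extends holomorphically to every domain on which
\<open>dirichlet 0\<close> avoids the cut of the logarithm. The component \<open>S\<close> of such points that contains the
positive axis is a connected open set, so a nonzero holomorphic function on it has countably many zeros.\<close>
lemma countable_inflection_fun_zeros:
  assumes "0 < u" "inflection_fun u \<noteq> 0"
  shows "countable {t. 0 < t \<and> inflection_fun t = 0}"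
proof -
  define U where "U = {z. 0 < Re z} \<inter> dirichlet 0 -` (- \<real>\<^sub>\<le>\<^sub>0)"
  define S where "S = connected_component_set U (of_real u)"
  define G :: "complex \<Rightarrow> complex" where
    "G z = 2 * Ln (dirichlet 0 z) * (dirichlet 2 z * dirichlet 0 z - (dirichlet 1 z)\<^sup>2) - (dirichlet 1 z)\<^sup>2" for z
  have hol: "dirichlet k holomorphic_on {z. 0 < Re z}" for k
    unfolding holomorphic_on_def
    using dirichlet_has_complex_derivative field_differentiable_def has_field_derivative_at_within by blast
  have real_in: "of_real t \<in> U" if "0 < t" for t
    using that dirichlet_pos[OF that] by (auto simp: U_def dirichlet_of_real complex_nonpos_Reals_iff)
  have "open U" unfolding U_def
    by (rule continuous_open_preimage[OF holomorphic_on_imp_continuous_on[OF hol]])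
       (auto simp: open_halfspace_Re_gt)
  then have oS: "open S" unfolding S_def by (rule open_connected_component)
  have cS: "connected S" unfolding S_def by simp
  have SU: "S \<subseteq> U" unfolding S_def by (rule connected_component_subset)
  have RS: "of_real t \<in> S" if "0 < t" for t
  proof -
    have "connected (complex_of_real ` {0<..})"
      by (intro connected_continuous_image continuous_intros) simp
    then have "complex_of_real ` {0<..} \<subseteq> S" unfolding S_def
      by (intro connected_component_maximal) (use assms real_in in auto)
    then show ?thesis using that by auto
  qed
  have hG: "G holomorphic_on S"
  proof -
    have "dirichlet k holomorphic_on S" for k
      by (rule holomorphic_on_subset[OF hol]) (use SU in \<open>auto simp: U_def\<close>)
    then show ?thesis unfolding G_def using SU
      by (intro holomorphic_intros) (auto simp: U_def)
  qed
  have Gt: "G (of_real t) = of_real ((dirichlet 0 t)\<^sup>2 * inflection_fun t)" if "0 < t" for t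
  proof -
    have "(dirichlet 0 t)\<^sup>2 * inflection_fun t = 2 * ln (dirichlet 0 t) * (dirichlet 2 t * dirichlet 0 t - (dirichlet 1 t)\<^sup>2) - (dirichlet 1 t)\<^sup>2"
      using dirichlet_pos[OF that] by (simp add: inflection_fun_def pressure_def exponent_variance_def mean_exponent_def power2_eq_square field_simps)
    then show ?thesis using dirichlet_pos[OF that]
      by (simp add: G_def dirichlet_of_real[OF that] Ln_of_real)
  qed
  have G0: "G (of_real t) = 0 \<longleftrightarrow> inflection_fun t = 0" if "0 < t" for t
    using Gt[OF that] dirichlet_pos[OF that] by simp
  obtain C where C: "\<And>n::nat. compact (C n)" "\<Union> (range C) = S"
    using open_Union_compact_subsets[OF oS] by metis
  then have fS: "fsigma S" using fsigma.intros[of C] compact_imp_closed by metis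
  show ?thesis
  proof (cases "G constant_on S")
    case True
    have "inflection_fun t \<noteq> 0" if "0 < t" for t
      using True RS[OF that] RS[OF assms(1)] G0[OF that] G0[OF assms(1)] assms(2) unfolding constant_on_def by auto
    then have "{t. 0 < t \<and> inflection_fun t = 0} = {}" by blast
    then show ?thesis by (metis countable_empty)
  next
    case False
    have "countable {z \<in> S. G z = 0}"
      using holomorphic_countable_zeros[OF hG oS cS fS False] .
    then have "countable (complex_of_real ` {t. 0 < t \<and> inflection_fun t = 0})"
      by (rule countable_subset[rotated]) (auto simp: RS G0)
    then show ?thesis by (rule countable_image_inj_on) (simp add: inj_on_def)
  qed
qed

text \<open>With finitely many zeros, the sign would be constant near \<open>0\<close>, and \<open>sqrt P\<close> would be convex or concave
there. A concave function on a bounded interval lies below its tangents and so is bounded above,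
whereas \<open>P\<close> is not; and the hypothesis says that convexity fails at midpoints.\<close>
lemma infinite_inflection_fun_zeros:
  assumes kink: "\<And>d. 0 < d \<Longrightarrow> \<exists>a b. 0 < a \<and> a < b \<and> b < d \<and>
      sqrt (pressure a) + sqrt (pressure b) < 2 * sqrt (pressure ((a + b) / 2))"
  shows "infinite {t. 0 < t \<and> inflection_fun t = 0}" "\<exists>t>0. inflection_fun t \<noteq> 0"
proof -
  have key: False if d: "0 < d" and nz: "(\<forall>t\<in>{0<..<d}. 0 \<le> inflection_fun t) \<or> (\<forall>t\<in>{0<..<d}. inflection_fun t \<le> 0)" for d
  proof -
    obtain d' where d': "d' > 0" "\<forall>t\<in>{0<..<d'}. 0 < pressure t" using pressure_at_0 by blast
    define C where "C = {0<..<min d d'}"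
    have C: "convex C" "0 < min d d'" using d d' by (auto simp: C_def)
    have CP: "0 < t" "0 < pressure t" if "t \<in> C" for t using that d'(2) by (auto simp: C_def)
    let ?F = "\<lambda>t. sqrt (pressure t)"
    let ?F' = "\<lambda>t. - mean_exponent t / (2 * sqrt (pressure t))"
    let ?F'' = "\<lambda>t. inflection_fun t / (4 * pressure t * sqrt (pressure t))"
    have F': "(?F has_real_derivative ?F' t) (at t)" if "t \<in> C" for t
      using CP[OF that] by (auto intro!: derivative_eq_intros pressure_has_derivative simp: field_simps)
    have F'': "(?F' has_real_derivative ?F'' t) (at t)" if "t \<in> C" for t
    proof -
      have s: "sqrt (pressure t) * sqrt (pressure t) = pressure t" "sqrt (pressure t) > 0" using CP[OF that] by auto
      show ?thesis using CP[OF that] s(2)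
        by (auto intro!: derivative_eq_intros pressure_has_derivative mean_exponent_has_derivative simp: inflection_fun_def)
           (simp add: field_simps power2_eq_square s)
    qed
    from nz show False
    proof
      assume left_end: "\<forall>t\<in>{0<..<d}. 0 \<le> inflection_fun t"
      have "convex_on C ?F"
        by (rule f''_ge0_imp_convex[OF C(1) F' F'']) (use left_end CP in \<open>auto simp: C_def intro!: divide_nonneg_pos mult_pos_pos\<close>)
      moreover obtain a b where ab: "0 < a" "a < b" "b < min d d'"
        and k: "?F a + ?F b < 2 * ?F ((a + b) / 2)" using kink[OF C(2)] by blast
      ultimately have "?F ((1 - 1/2) *\<^sub>R a + (1/2) *\<^sub>R b) \<le> (1 - 1/2) * ?F a + (1/2) * ?F b"
        by (intro convex_onD) (auto simp: C_def)
      moreover have "(1 - 1/2) *\<^sub>R a + (1/2) *\<^sub>R b = (a + b) / 2" by (simp add: field_simps)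
      ultimately show False using k by (simp add: add_divide_distrib)
    next
      assume neg: "\<forall>t\<in>{0<..<d}. inflection_fun t \<le> 0"
      \<comment> \<open>the point at which the tangent is taken\<close>
      define c where "c = min d d' / 2"
      have c: "c \<in> C" using C(2) by (auto simp: C_def c_def)
      have bd: "?F t \<le> ?F c + \<bar>?F' c\<bar> * d" if t: "t \<in> C" for t
      proof -
        have "- ?F' c * (t - c) \<le> - ?F t - - ?F c"
        proof (rule f''_imp_f'[OF C(1), where f'' = "\<lambda>t. - ?F'' t"])
          show "0 \<le> - ?F'' t" if "t \<in> C" for t
            using neg that CP[OF that] by (auto simp: C_def divide_nonpos_pos)
        qed (use c t DERIV_minus[OF F'] DERIV_minus[OF F''] in blast)+
        moreover have "?F' c * (t - c) \<le> \<bar>?F' c\<bar> * d"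
        proof -
          have "?F' c * (t - c) \<le> \<bar>?F' c\<bar> * \<bar>t - c\<bar>" by (metis abs_ge_self abs_mult)
          also have "\<dots> \<le> \<bar>?F' c\<bar> * d" using t c by (intro mult_left_mono) (auto simp: C_def)
          finally show ?thesis .
        qed
        ultimately show ?thesis by simp
      qed
      let ?K = "?F c + \<bar>?F' c\<bar> * d"
      obtain e where e: "e > 0" "\<forall>t\<in>{0<..<e}. ?K\<^sup>2 < pressure t" using pressure_at_0 by blast
      define t where "t = min e (min d d') / 2"
      have t: "t \<in> C" "t \<in> {0<..<e}" using e C(2) by (auto simp: t_def C_def)
      have "\<bar>?K\<bar> < ?F t" using e(2) t(2) real_less_rsqrt by (metis real_sqrt_abs real_sqrt_less_iff)
      with bd[OF t(1)] show False by simp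
    qed
  qed
  show "\<exists>t>0. inflection_fun t \<noteq> 0" using key[of 1] by (metis greaterThanLessThan_iff order_refl zero_less_one)
  show "infinite {t. 0 < t \<and> inflection_fun t = 0}"
  proof
    assume fin: "finite {t. 0 < t \<and> inflection_fun t = 0}"
    define d where "d = Min (insert 1 {t. 0 < t \<and> inflection_fun t = 0})"
    have d: "0 < d" using fin by (auto simp: d_def)
    have nz: "inflection_fun t \<noteq> 0" if "t \<in> {0<..<d}" for t
    proof
      assume "inflection_fun t = 0"
      then have "d \<le> t" unfolding d_def using that fin by (intro Min_le) auto
      then show False using that by simp
    qed
    have con: "connected (inflection_fun ` {0<..<d})"
      by (intro connected_continuous_image continuous_at_imp_continuous_on ballI inflection_fun_continuous) auto
    have "(\<forall>t\<in>{0<..<d}. 0 \<le> inflection_fun t) \<or> (\<forall>t\<in>{0<..<d}. inflection_fun t \<le> 0)"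
    proof (rule ccontr)
      assume "\<not> ?thesis"
      then obtain s t where st: "s \<in> {0<..<d}" "t \<in> {0<..<d}" "inflection_fun s < 0" "0 < inflection_fun t" by force
      then have "{inflection_fun s..inflection_fun t} \<subseteq> inflection_fun ` {0<..<d}" by (intro connected_contains_Icc[OF con]) auto
      moreover have "0 \<in> {inflection_fun s..inflection_fun t}" using st by simp
      ultimately have "0 \<in> inflection_fun ` {0<..<d}" by blast
      then show False using nz by force
    qed
    then show False using key[OF d] by blast
  qed
qed

end

section \<open>Bernoulli measures on itineraries\<close>

context gap_system
begin

definition gibbs :: "real \<Rightarrow> nat pmf" where
  "gibbs t = embed_pmf (\<lambda>i. exp (- lam i * t - pressure t))"

lemma pmf_gibbs:
  assumes "0 < t" shows "pmf (gibbs t) i = exp (- lam i * t - pressure t)"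
  unfolding gibbs_def
proof (rule pmf_embed_pmf)
  have "(\<lambda>i. exp (- lam i * t) / dirichlet 0 t) sums (dirichlet 0 t / dirichlet 0 t)"
    by (intro sums_divide exp_sums_dirichlet assms)
  then have s: "(\<lambda>i. exp (- lam i * t - pressure t)) sums 1"
    using dirichlet_pos[OF assms] by (simp add: exp_diff exp_pressure[OF assms])
  have "(\<integral>\<^sup>+ i. ennreal (exp (- lam i * t - pressure t)) \<partial>count_space UNIV)
      = (\<Sum>i. ennreal (exp (- lam i * t - pressure t)))" by (rule nn_integral_count_space_nat)
  also have "\<dots> = ennreal 1"
    using s by (subst suminf_ennreal2) (auto simp: sums_iff)
  finally show "(\<integral>\<^sup>+ i. ennreal (exp (- lam i * t - pressure t)) \<partial>count_space UNIV) = 1" by simp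
qed simp

definition bernoulli :: "real \<Rightarrow> (nat \<Rightarrow> nat) measure" where
  "bernoulli t = PiM UNIV (\<lambda>_. measure_pmf (gibbs t))"

definition word_sum :: "nat list \<Rightarrow> real" where "word_sum w = sum_list (map lam w)"

definition gibbs_weight :: "real \<Rightarrow> nat list \<Rightarrow> real" where
  "gibbs_weight t w = exp (- t * word_sum w - real (length w) * pressure t)"

definition word_cylinder :: "nat list \<Rightarrow> (nat \<Rightarrow> nat) set" where
  "word_cylinder w = {\<omega>. \<forall>k<length w. \<omega> k = w ! k}"

definition first_letters :: "(nat \<Rightarrow> nat) \<Rightarrow> nat \<Rightarrow> nat list" where "first_letters \<omega> n = map \<omega> [0..<n]"

lemma length_first_letters [simp]: "length (first_letters \<omega> n) = n" by (simp add: first_letters_def)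

lemma mem_word_cylinder_iff: "\<omega> \<in> word_cylinder w \<longleftrightarrow> w = first_letters \<omega> (length w)"
  unfolding word_cylinder_def first_letters_def list_eq_iff_nth_eq by simp metis

lemma word_sum_first_letters: "word_sum (first_letters \<omega> n) = birkhoff_sum \<omega> n"
  by (simp add: word_sum_def first_letters_def birkhoff_sum_def interv_sum_list_conv_sum_set_nat atLeast0LessThan o_def)

lemma word_sum_conv: "word_sum w = (\<Sum>k<length w. lam (w ! k))"
  by (simp add: word_sum_def sum_list_sum_nth atLeast0LessThan)

lemma space_bernoulli [simp]: "space (bernoulli t) = UNIV"
  by (simp add: bernoulli_def space_PiM)

lemma prob_space_bernoulli: "prob_space (bernoulli t)"
  unfolding bernoulli_def by (intro prob_space_PiM measure_pmf.prob_space_axioms)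

lemma emeasure_word_cylinder:
  assumes "0 < t" shows "emeasure (bernoulli t) (word_cylinder w) = ennreal (gibbs_weight t w)"
proof -
  interpret product_prob_space "\<lambda>_::nat. measure_pmf (gibbs t)" UNIV by unfold_locales
  have "word_cylinder w = {\<omega> \<in> space (bernoulli t). \<forall>k\<in>{..<length w}. \<omega> k \<in> {w ! k}}" by (auto simp: word_cylinder_def)
  then have "emeasure (bernoulli t) (word_cylinder w) = (\<Prod>k<length w. emeasure (measure_pmf (gibbs t)) {w ! k})"
    unfolding bernoulli_def by (simp only:) (rule emeasure_PiM_Collect; simp)
  also have "\<dots> = (\<Prod>k<length w. ennreal (exp (- lam (w ! k) * t - pressure t)))"
    by (simp add: emeasure_pmf_single pmf_gibbs[OF assms])
  also have "\<dots> = ennreal (\<Prod>k<length w. exp (- lam (w ! k) * t - pressure t))" by (simp add: prod_ennreal)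
  also have "(\<Prod>k<length w. exp (- lam (w ! k) * t - pressure t)) = exp (\<Sum>k<length w. - lam (w ! k) * t - pressure t)"
    by (simp add: exp_sum)
  also have "(\<Sum>k<length w. - lam (w ! k) * t - pressure t) = - t * word_sum w - real (length w) * pressure t"
    by (simp add: word_sum_conv sum_subtractf sum_distrib_left sum_negf mult.commute)
  finally show ?thesis by (simp add: gibbs_weight_def)
qed

lemma sets_word_cylinder: "word_cylinder w \<in> sets (bernoulli t)"
proof -
  have "(\<lambda>\<omega>. \<omega> k) \<in> bernoulli t \<rightarrow>\<^sub>M measure_pmf (gibbs t)" for k
    unfolding bernoulli_def by (rule measurable_component_singleton) simp
  then have "(\<lambda>\<omega>. \<omega> k) -` {i} \<inter> space (bernoulli t) \<in> sets (bernoulli t)" for k i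
    by (rule measurable_sets) simp
  then have *: "{\<omega>. \<omega> k = i} \<in> sets (bernoulli t)" for k i
    by (simp add: vimage_def)
  have "{\<omega> \<in> space (bernoulli t). \<forall>k\<in>{..<length w}. \<omega> k = w ! k} \<in> sets (bernoulli t)"
    by (rule sets.sets_Collect_finite_All) (use * in simp_all)
  moreover have "{\<omega> \<in> space (bernoulli t). \<forall>k\<in>{..<length w}. \<omega> k = w ! k} = word_cylinder w" by (auto simp: word_cylinder_def)
  ultimately show ?thesis by metis
qed

text \<open>Events that depend on the first \<open>n\<close> letters are countable unions of cylinders; this supplies all the
measurability needed below.\<close>
lemma prefix_event_eq: "{\<omega>. P (first_letters \<omega> n)} = (\<Union>w\<in>{w. length w = n \<and> P w}. word_cylinder w)"
proof (intro set_eqI iffI)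
  fix \<omega> assume "\<omega> \<in> {\<omega>. P (first_letters \<omega> n)}"
  then have "first_letters \<omega> n \<in> {w. length w = n \<and> P w}" by simp
  moreover have "\<omega> \<in> word_cylinder (first_letters \<omega> n)" unfolding mem_word_cylinder_iff by simp
  ultimately show "\<omega> \<in> (\<Union>w\<in>{w. length w = n \<and> P w}. word_cylinder w)" by (rule UN_I)
next
  fix \<omega> assume "\<omega> \<in> (\<Union>w\<in>{w. length w = n \<and> P w}. word_cylinder w)"
  then obtain w where w: "length w = n" "P w" "\<omega> \<in> word_cylinder w" by blast
  then have "w = first_letters \<omega> n" using mem_word_cylinder_iff[of \<omega> w] by metis
  then have "P (first_letters \<omega> n)" using w(2) by (rule subst)
  then show "\<omega> \<in> {\<omega>. P (first_letters \<omega> n)}" by (simp only: mem_Collect_eq)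
qed

lemma sets_word_cylinder_Union: "(\<Union>w\<in>W. word_cylinder w) \<in> sets (bernoulli t)"
  by (intro sets.countable_UN'' countableI_type sets_word_cylinder)

lemma sets_prefix_event: "{\<omega>. P (first_letters \<omega> n)} \<in> sets (bernoulli t)"
  unfolding prefix_event_eq by (rule sets_word_cylinder_Union)

lemma emeasure_word_cylinder_Union:
  assumes "0 < t" "W \<subseteq> {w. length w = n}"
  shows "emeasure (bernoulli t) (\<Union>w\<in>W. word_cylinder w) = (\<integral>\<^sup>+w. ennreal (gibbs_weight t w) \<partial>count_space W)"
proof -
  have "disjoint_family_on word_cylinder W"
    unfolding disjoint_family_on_def
  proof (intro ballI impI)
    fix v w assume vw: "v \<in> W" "w \<in> W" "v \<noteq> w"
    then have "length v = n" "length w = n" using assms(2) by auto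
    then show "word_cylinder v \<inter> word_cylinder w = {}" using vw(3) mem_word_cylinder_iff[of _ v] mem_word_cylinder_iff[of _ w] by (metis disjoint_iff)
  qed
  then show ?thesis
    by (subst emeasure_UN_countable) (simp_all add: emeasure_word_cylinder[OF assms(1)] sets_word_cylinder)
qed

text \<open>The weights of words of equal length are the masses of disjoint cylinders. Applied at another parameter
than that of the measure under study, this bound takes the place of exponential moments.\<close>
lemma gibbs_weight_sum_le_1:
  assumes "0 < t" "W \<subseteq> {w. length w = n}"
  shows "(\<integral>\<^sup>+w. ennreal (gibbs_weight t w) \<partial>count_space W) \<le> 1"
  unfolding emeasure_word_cylinder_Union[OF assms, symmetric] by (rule prob_space.emeasure_le_1[OF prob_space_bernoulli])

text \<open>Change of measure: \<open>gibbs_weight t w\<close> is \<open>gibbs_weight u w\<close> times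
\<open>exp ((u - t) * word_sum w + n * (pressure u - pressure t))\<close>, which on the words of the event is at most
the bound claimed, and the weights at \<open>u\<close> sum to at most \<open>1\<close>.\<close>
lemma chernoff:
  assumes "0 < t" "0 < u"
  shows "emeasure (bernoulli t) {\<omega>. (u - t) * birkhoff_sum \<omega> n \<le> real n * y} \<le> ennreal (exp (real n * (y + pressure u - pressure t)))"
    and "{\<omega>. (u - t) * birkhoff_sum \<omega> n \<le> real n * y} \<in> sets (bernoulli t)"
proof -
  define W where "W = {w. length w = n \<and> (u - t) * word_sum w \<le> real n * y}"
  let ?c = "exp (real n * (y + pressure u - pressure t))"
  have eq: "{\<omega>. (u - t) * birkhoff_sum \<omega> n \<le> real n * y} = (\<Union>w\<in>W. word_cylinder w)"
    using prefix_event_eq[of "\<lambda>w. (u - t) * word_sum w \<le> real n * y" n] by (simp add: W_def word_sum_first_letters)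
  show "{\<omega>. (u - t) * birkhoff_sum \<omega> n \<le> real n * y} \<in> sets (bernoulli t)"
    unfolding eq by (rule sets_word_cylinder_Union)
  have W: "W \<subseteq> {w. length w = n}" by (auto simp: W_def)
  have le: "gibbs_weight t w \<le> ?c * gibbs_weight u w" if "w \<in> W" for w
    using that unfolding gibbs_weight_def W_def by (simp add: mult_exp_exp algebra_simps)
  have "(\<integral>\<^sup>+w. ennreal (gibbs_weight t w) \<partial>count_space W) \<le> (\<integral>\<^sup>+w. ennreal ?c * ennreal (gibbs_weight u w) \<partial>count_space W)"
    by (rule nn_integral_mono) (use le in \<open>auto simp: ennreal_mult[symmetric] gibbs_weight_def intro!: ennreal_leI\<close>)
  also have "\<dots> = ennreal ?c * (\<integral>\<^sup>+w. ennreal (gibbs_weight u w) \<partial>count_space W)"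
    by (rule nn_integral_cmult) simp
  also have "\<dots> \<le> ennreal ?c * 1"
    by (intro mult_left_mono gibbs_weight_sum_le_1[OF assms(2) W]) simp
  finally show "emeasure (bernoulli t) {\<omega>. (u - t) * birkhoff_sum \<omega> n \<le> real n * y} \<le> ennreal ?c"
    unfolding eq emeasure_word_cylinder_Union[OF assms(1) W] by simp
qed

lemma AE_large_deviation:
  assumes "0 < t" "0 < u" "y + pressure u - pressure t < 0"
  shows "AE \<omega> in bernoulli t. \<forall>\<^sub>F n in sequentially. real n * y < (u - t) * birkhoff_sum \<omega> n"
proof -
  interpret M: prob_space "bernoulli t" by (rule prob_space_bernoulli)
  let ?A = "\<lambda>n. {\<omega>. (u - t) * birkhoff_sum \<omega> n \<le> real n * y}"
  define q where "q = exp (y + pressure u - pressure t)"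
  have q: "0 < q" "q < 1" using assms(3) by (auto simp: q_def)
  have le: "measure (bernoulli t) (?A n) \<le> q ^ n" for n
    using chernoff(1)[OF assms(1,2), of n y] unfolding q_def exp_of_nat_mult[symmetric]
    by (simp add: M.emeasure_eq_measure ennreal_le_iff)
  have "AE \<omega> in bernoulli t. \<forall>\<^sub>F n in sequentially. \<omega> \<in> space (bernoulli t) - ?A n"
  proof (rule borel_cantelli_AE1)
    show "summable (\<lambda>n. measure (bernoulli t) (?A n))"
      by (rule summable_comparison_test'[OF summable_geometric[of q]]) (use le q in auto)
  qed (auto intro: chernoff(2)[OF assms(1,2)] simp: M.emeasure_eq_measure)
  then show ?thesis by eventually_elim (auto simp: not_le elim: eventually_mono)
qed

text \<open>The strong law of large numbers. Since \<open>P' t = - mean_exponent t\<close>, a parameter slightly below \<open>t\<close> makes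
the Chernoff bound for \<open>birkhoff_sum \<omega> n \<ge> n * (mean_exponent t + e)\<close> decay exponentially, and one
slightly above \<open>t\<close> does so for the lower deviations; then the Borel-Cantelli lemma applies.\<close>
lemma AE_birkhoff:
  assumes t: "0 < t"
  shows "AE \<omega> in bernoulli t. (\<lambda>n. birkhoff_sum \<omega> n / real n) \<longlonglongrightarrow> mean_exponent t"
proof -
  have up: "AE \<omega> in bernoulli t. \<forall>\<^sub>F n in sequentially. birkhoff_sum \<omega> n < real n * (mean_exponent t + e)" if "0 < e" for e
  proof -
    have "((\<lambda>x. pressure x + (mean_exponent t + e) * x) has_real_derivative e) (at t)"
      by (auto intro!: derivative_eq_intros pressure_has_derivative t)
    from DERIV_pos_inc_left[OF this that] obtain d where d: "d > 0"
      "\<And>h. 0 < h \<Longrightarrow> h < d \<Longrightarrow> pressure (t - h) + (mean_exponent t + e) * (t - h) < pressure t + (mean_exponent t + e) * t" by blast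
    define h where "h = min d t / 2"
    have h: "0 < h" "h < d" "0 < t - h" using d t by (auto simp: h_def)
    have "AE \<omega> in bernoulli t. \<forall>\<^sub>F n in sequentially. real n * (- h * (mean_exponent t + e)) < (t - h - t) * birkhoff_sum \<omega> n"
      by (rule AE_large_deviation[OF t h(3)]) (use d(2)[OF h(1,2)] in \<open>simp add: algebra_simps\<close>)
    then show ?thesis
    proof eventually_elim
      case (elim \<omega>)
      then show ?case
      proof eventually_elim
        case (elim n)
        then have "h * birkhoff_sum \<omega> n < h * (real n * (mean_exponent t + e))" by (simp add: algebra_simps)
        then show ?case using h(1) by simp
      qed
    qed
  qed
  have lo: "AE \<omega> in bernoulli t. \<forall>\<^sub>F n in sequentially. real n * (mean_exponent t - e) < birkhoff_sum \<omega> n" if "0 < e" for e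
  proof -
    have "((\<lambda>x. pressure x + (mean_exponent t - e) * x) has_real_derivative - e) (at t)"
      by (auto intro!: derivative_eq_intros pressure_has_derivative t)
    from DERIV_neg_dec_right[OF this] that obtain d where d: "d > 0"
      "\<And>h. 0 < h \<Longrightarrow> h < d \<Longrightarrow> pressure (t + h) + (mean_exponent t - e) * (t + h) < pressure t + (mean_exponent t - e) * t" by auto
    define h where "h = d / 2"
    have h: "0 < h" "h < d" "0 < t + h" using d t by (auto simp: h_def)
    have "AE \<omega> in bernoulli t. \<forall>\<^sub>F n in sequentially. real n * (h * (mean_exponent t - e)) < (t + h - t) * birkhoff_sum \<omega> n"
      by (rule AE_large_deviation[OF t h(3)]) (use d(2)[OF h(1,2)] in \<open>simp add: algebra_simps\<close>)
    then show ?thesis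
    proof eventually_elim
      case (elim \<omega>)
      then show ?case
      proof eventually_elim
        case (elim n)
        then have "h * (real n * (mean_exponent t - e)) < h * birkhoff_sum \<omega> n" by (simp add: algebra_simps)
        then show ?case using h(1) by simp
      qed
    qed
  qed
  have "AE \<omega> in bernoulli t. \<forall>m. \<forall>\<^sub>F n in sequentially. birkhoff_sum \<omega> n < real n * (mean_exponent t + 1 / Suc m)"
    unfolding AE_all_countable using up by simp
  moreover have "AE \<omega> in bernoulli t. \<forall>m. \<forall>\<^sub>F n in sequentially. real n * (mean_exponent t - 1 / Suc m) < birkhoff_sum \<omega> n"
    unfolding AE_all_countable using lo by simp
  ultimately show ?thesis
  proof eventually_elim
    case (elim \<omega>)
    show ?case
    proof (rule tendstoI)
      fix e :: real assume "0 < e"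
      then obtain m where m: "1 / Suc m < e" using nat_approx_posE by blast
      show "\<forall>\<^sub>F n in sequentially. dist (birkhoff_sum \<omega> n / real n) (mean_exponent t) < e"
        using elim(1)[rule_format, of m] elim(2)[rule_format, of m] eventually_gt_at_top[of 0]
      proof eventually_elim
        case (elim n)
        then have "birkhoff_sum \<omega> n / real n < mean_exponent t + 1 / Suc m" "mean_exponent t - 1 / Suc m < birkhoff_sum \<omega> n / real n"
          by (simp_all add: field_simps)
        then show ?case using m unfolding dist_real_def by linarith
      qed
    qed
  qed
qed

end

section \<open>Hausdorff dimension of the level sets\<close>

context gap_system
begin

definition level_set :: "real \<Rightarrow> real set" where
  "level_set a = {x \<in> invariant_set branch branch_map. has_lyapunov_exponent branch branch_map x a}"

lemma word_sum_bound:
  assumes t: "0 < t" and c: "0 < c"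
  shows "(\<integral>\<^sup>+w. (if M \<le> length w then ennreal (exp (- c * real (length w)) * gibbs_weight t w) else 0) \<partial>count_space UNIV)
    \<le> ennreal (exp (- c) ^ M / (1 - exp (- c)))"
proof -
  define q where "q = exp (- c)"
  have q: "0 < q" "q < 1" using c by (auto simp: q_def)
  have qn: "exp (- (c * real n)) = q ^ n" for n
    by (simp add: q_def exp_of_nat_mult[symmetric] mult.commute)
  let ?f = "\<lambda>n w. (if length w = n + M then ennreal (q ^ (n + M) * gibbs_weight t w) else 0)"
  have "(\<integral>\<^sup>+w. (if M \<le> length w then ennreal (exp (- c * real (length w)) * gibbs_weight t w) else 0) \<partial>count_space UNIV)
      = (\<integral>\<^sup>+w. (\<Sum>n. ?f n w) \<partial>count_space UNIV)"
  proof (rule nn_integral_cong)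
    fix w :: "nat list"
    have "(\<Sum>n. ?f n w) = (\<Sum>n\<in>{n. length w = n + M}. ?f n w)"
      by (rule suminf_finite) (auto intro: finite_subset[of _ "{..length w}"])
    also have "\<dots> = (if M \<le> length w then ennreal (exp (- c * real (length w)) * gibbs_weight t w) else 0)"
    proof (cases "M \<le> length w")
      case True
      then have "{n. length w = n + M} = {length w - M}" by auto
      then show ?thesis using True by (simp add: qn)
    next
      case False
      then have "{n. length w = n + M} = {}" by auto
      then show ?thesis using False by simp
    qed
    finally show "(if M \<le> length w then ennreal (exp (- c * real (length w)) * gibbs_weight t w) else 0) = (\<Sum>n. ?f n w)" ..
  qed
  also have "\<dots> = (\<Sum>n. \<integral>\<^sup>+w. ?f n w \<partial>count_space UNIV)"
    by (rule nn_integral_suminf) simp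
  also have "\<dots> \<le> (\<Sum>n. ennreal (q ^ (n + M)))"
  proof (rule suminf_le)
    fix n
    let ?W = "{w::nat list. length w = n + M}"
    have "(\<integral>\<^sup>+w. ?f n w \<partial>count_space UNIV)
        = (\<integral>\<^sup>+w. ennreal (q ^ (n + M)) * (ennreal (gibbs_weight t w) * indicator ?W w) \<partial>count_space UNIV)"
      using q by (intro nn_integral_cong) (auto simp: ennreal_mult[symmetric] gibbs_weight_def indicator_def)
    also have "\<dots> = ennreal (q ^ (n + M)) * (\<integral>\<^sup>+w. ennreal (gibbs_weight t w) * indicator ?W w \<partial>count_space UNIV)"
      by (rule nn_integral_cmult) simp
    also have "(\<integral>\<^sup>+w. ennreal (gibbs_weight t w) * indicator ?W w \<partial>count_space UNIV) = (\<integral>\<^sup>+w. ennreal (gibbs_weight t w) \<partial>count_space ?W)"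
      by (rule nn_integral_count_space_indicator[symmetric]) simp
    also have "ennreal (q ^ (n + M)) * \<dots> \<le> ennreal (q ^ (n + M)) * 1"
      by (intro mult_left_mono gibbs_weight_sum_le_1[OF t]) auto
    finally show "(\<integral>\<^sup>+w. ?f n w \<partial>count_space UNIV) \<le> ennreal (q ^ (n + M))" by simp
  qed auto
  also have "\<dots> = ennreal (q ^ M / (1 - q))"
  proof -
    have "(\<lambda>n. q ^ M * q ^ n) sums (q ^ M * (1 / (1 - q)))"
      by (intro sums_mult geometric_sums) (use q in simp)
    then have "(\<lambda>n. q ^ (n + M)) sums (q ^ M / (1 - q))" by (simp add: power_add mult.commute)
    then show ?thesis using q by (subst suminf_ennreal2) (auto simp: sums_iff)
  qed
  finally show ?thesis unfolding q_def .
qed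

lemma hausdorff_gauge_le:
  fixes U :: "real set"
  assumes "0 \<le> s" "bounded U" "diameter U \<le> exp (- b)"
  shows "hausdorff_gauge s U \<le> ennreal (exp (- s * b))"
proof -
  have "diameter U powr s \<le> exp (- b) powr s"
    by (rule powr_mono2) (use assms diameter_ge_0 in auto)
  also have "\<dots> = exp (- s * b)" by (simp add: powr_def)
  finally show ?thesis unfolding hausdorff_gauge_def by (auto intro: ennreal_leI)
qed

lemma follows_cong: "(\<And>k. k < n \<Longrightarrow> \<omega> k = \<omega>' k) \<Longrightarrow> follows n \<omega> = follows n \<omega>'"
  by (auto simp: follows_def)

text \<open>As \<open>pressure t < (s - t) * a\<close>, there is \<open>c > 0\<close> such that all long enough initial words \<open>w\<close> of the
itinerary of a point with exponent \<open>a\<close> satisfy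
\<open>exp (- s * word_sum w) \<le> exp (- c * length w) * gibbs_weight t w\<close>. The cylinders of such words of length
at least \<open>M\<close> cover the level set, and since the weights of each length sum to at most \<open>1\<close>, their
\<open>s\<close>-dimensional sizes sum to the tail of a geometric series.\<close>
lemma hausdorff_measure_level_set_eq_0:
  assumes t: "0 < t" and s: "0 \<le> s" and gap: "pressure t < (s - t) * a"
  shows "hausdorff_measure s (level_set a) = 0"
proof -
  define c where "c = ((s - t) * a - pressure t) / 2"
  have c: "0 < c" "pressure t + c < (s - t) * a" using gap by (auto simp: c_def field_simps)
  define good where "good M w \<longleftrightarrow> M \<le> length w \<and> exp (- s * word_sum w) \<le> exp (- c * real (length w)) * gibbs_weight t w" for M w
  define U where "U M i = (let w = list_decode i in if good M w then follows (length w) (\<lambda>k. w ! k) else {})" for M i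
  have birkhoff_sum_nth: "birkhoff_sum (\<lambda>k. w ! k) (length w) = word_sum w" for w
    by (simp add: birkhoff_sum_def word_sum_conv)
  have cover: "level_set a \<subseteq> (\<Union>i. U M i)" for M
  proof
    fix x assume x: "x \<in> level_set a"
    then have inv: "x \<in> invariant_set branch branch_map"
      and lim: "(\<lambda>n. birkhoff_sum (itinerary x) n / real n) \<longlonglongrightarrow> a"
      using has_lyapunov_exponent_iff by (auto simp: level_set_def)
    have "(\<lambda>n. (s - t) * (birkhoff_sum (itinerary x) n / real n)) \<longlonglongrightarrow> (s - t) * a" by (intro tendsto_intros lim)
    then have "\<forall>\<^sub>F n in sequentially. pressure t + c < (s - t) * (birkhoff_sum (itinerary x) n / real n)"
      using c(2) by (rule order_tendstoD)
    from eventually_happens'[OF _ eventually_conj[OF this eventually_gt_at_top[of M]]]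
    obtain n where n: "pressure t + c < (s - t) * (birkhoff_sum (itinerary x) n / real n)" "M < n" by auto
    define w where "w = first_letters (itinerary x) n"
    have "real n * (pressure t + c) < (s - t) * birkhoff_sum (itinerary x) n" using n by (simp add: field_simps)
    then have "good M w" using n(2)
      by (simp add: good_def w_def word_sum_first_letters gibbs_weight_def mult_exp_exp algebra_simps)
    moreover have "x \<in> follows (length w) (\<lambda>k. w ! k)"
      using invariant_set_follows[OF inv, of n] follows_cong[of n "itinerary x" "\<lambda>k. w ! k"]
      by (simp add: w_def first_letters_def)
    ultimately have "x \<in> U M (list_encode w)" by (simp add: U_def)
    then show "x \<in> (\<Union>i. U M i)" by blast
  qed
  have bd: "bounded (U M i) \<and> diameter (U M i) \<le> exp (- lam 0) ^ M" for M i
  proof (cases "good M (list_decode i)")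
    case True
    define w where "w = list_decode i"
    have "real M * lam 0 \<le> real (length w) * lam 0"
      using True lam_pos by (simp add: good_def w_def)
    also have "\<dots> \<le> birkhoff_sum (\<lambda>k. w ! k) (length w)" by (rule birkhoff_sum_lower)
    finally have "exp (- birkhoff_sum (\<lambda>k. w ! k) (length w)) \<le> exp (real M * - lam 0)" by simp
    also have "\<dots> = exp (- lam 0) ^ M" by (rule exp_of_nat_mult)
    finally show ?thesis using True follows_diameter[of "length w" "\<lambda>k. w ! k"]
      unfolding U_def Let_def w_def[symmetric] by simp
  qed (simp add: U_def Let_def)
  have gauge: "hausdorff_gauge s (U M i) \<le> (let w = list_decode i in
      if M \<le> length w then ennreal (exp (- c * real (length w)) * gibbs_weight t w) else 0)" for M i
  proof (cases "good M (list_decode i)")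
    case True
    define w where "w = list_decode i"
    have "hausdorff_gauge s (U M i) \<le> ennreal (exp (- s * word_sum w))"
      using True follows_diameter[of "length w" "\<lambda>k. w ! k"]
      by (intro hausdorff_gauge_le s) (simp_all add: U_def w_def[symmetric] Let_def birkhoff_sum_nth)
    also have "\<dots> \<le> ennreal (exp (- c * real (length w)) * gibbs_weight t w)"
      using True by (intro ennreal_leI) (simp add: good_def w_def)
    finally show ?thesis using True by (simp add: good_def w_def Let_def)
  qed (simp add: U_def hausdorff_gauge_def Let_def)
  have "hausdorff_premeasure s \<delta> (level_set a) = 0" if "0 < \<delta>" for \<delta>
  proof -
    have pre: "hausdorff_premeasure s \<delta> (level_set a) \<le> ennreal (exp (- c) ^ M / (1 - exp (- c)))"
      if M: "exp (- lam 0) ^ M \<le> \<delta>" for M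
    proof -
      have "hausdorff_premeasure s \<delta> (level_set a) \<le> (\<Sum>i. hausdorff_gauge s (U M i))"
        unfolding hausdorff_premeasure_def
        by (rule INF_lower) (use cover bd M order_trans in blast)
      also have "\<dots> \<le> (\<Sum>i. let w = list_decode i in
          if M \<le> length w then ennreal (exp (- c * real (length w)) * gibbs_weight t w) else 0)"
        by (intro suminf_le gauge) auto
      also have "\<dots> = (\<integral>\<^sup>+w. (if M \<le> length w then ennreal (exp (- c * real (length w)) * gibbs_weight t w) else 0) \<partial>count_space UNIV)"
        unfolding Let_def nn_integral_count_space_nat[symmetric]
        by (rule nn_integral_bij_count_space) (simp add: bij_list_decode)
      also have "\<dots> \<le> ennreal (exp (- c) ^ M / (1 - exp (- c)))" by (rule word_sum_bound[OF t c(1)])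
      finally show ?thesis .
    qed
    have "(\<lambda>M. exp (- lam 0) ^ M) \<longlonglongrightarrow> 0" by (rule LIMSEQ_power_zero) (use lam_pos in simp)
    then have "\<forall>\<^sub>F M in sequentially. exp (- lam 0) ^ M < \<delta>" using \<open>0 < \<delta>\<close> by (rule order_tendstoD)
    then have ev: "\<forall>\<^sub>F M in sequentially. hausdorff_premeasure s \<delta> (level_set a) \<le> ennreal (exp (- c) ^ M / (1 - exp (- c)))"
      by eventually_elim (rule pre, simp)
    have "(\<lambda>M. exp (- c) ^ M / (1 - exp (- c))) \<longlonglongrightarrow> 0 / (1 - exp (- c))"
      by (intro tendsto_divide LIMSEQ_power_zero tendsto_const) (use c in auto)
    then have "(\<lambda>M. ennreal (exp (- c) ^ M / (1 - exp (- c)))) \<longlonglongrightarrow> ennreal 0"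
      by (intro tendsto_ennrealI) simp
    from tendsto_lowerbound[OF this ev] show ?thesis by simp
  qed
  then show ?thesis unfolding hausdorff_measure_def by simp
qed

lemma gibbs_weight_first_letters_le:
  assumes "0 < t" shows "gibbs_weight t (first_letters \<omega> n) \<le> exp (- t * lam 0 - pressure t) ^ n"
proof -
  have "t * (real n * lam 0) \<le> t * birkhoff_sum \<omega> n" using assms birkhoff_sum_lower by (intro mult_left_mono) auto
  then have "gibbs_weight t (first_letters \<omega> n) \<le> exp (real n * (- t * lam 0 - pressure t))"
    by (simp add: gibbs_weight_def word_sum_first_letters algebra_simps)
  then show ?thesis by (simp add: exp_of_nat_mult)
qed

lemma mem_word_cylinder_first_letters: "\<omega>' \<in> word_cylinder (first_letters \<omega> n) \<longleftrightarrow> (\<forall>k<n. \<omega>' k = \<omega> k)"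
  by (simp add: word_cylinder_def first_letters_def)

text \<open>The step of the mass distribution principle. Let \<open>n\<close> be the first index at which two itineraries in \<open>Q\<close>
differ. All of \<open>Q\<close> lies in one cylinder of rank \<open>n\<close>, and because of the gaps the diameter of \<open>U\<close> is at
least the length of the child of rank \<open>n + 1\<close> along any itinerary in \<open>Q\<close>. The hypothesis compares the
mass of the parent with the length of the child, so no ratio of lengths of consecutive cylinders has to
be bounded, although there are infinitely many branches. If all of \<open>Q\<close> is a single itinerary, its mass
is \<open>0\<close>.\<close>
lemma mass_of_set:
  assumes t: "0 < t" and s: "0 \<le> s" and C: "0 \<le> C" and U: "bounded U"
    and Q: "\<And>\<omega> n. \<omega> \<in> Q \<Longrightarrow> gibbs_weight t (first_letters \<omega> n) \<le> C * exp (- s * birkhoff_sum \<omega> (Suc n))"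
    and QU: "\<And>\<omega>. \<omega> \<in> Q \<Longrightarrow> coded_point \<omega> \<in> U"
  shows "\<exists>V\<in>sets (bernoulli t). Q \<subseteq> V \<and> emeasure (bernoulli t) V \<le> ennreal C * hausdorff_gauge s U"
proof -
  interpret M: prob_space "bernoulli t" by (rule prob_space_bernoulli)
  show ?thesis
  proof (cases "\<exists>n. \<exists>\<omega>\<in>Q. \<exists>\<omega>'\<in>Q. \<omega> n \<noteq> \<omega>' n")
    case True
    define n where "n = (LEAST n. \<exists>\<omega>\<in>Q. \<exists>\<omega>'\<in>Q. \<omega> n \<noteq> \<omega>' n)"
    from LeastI_ex[OF True] obtain \<omega> \<omega>' where o: "\<omega> \<in> Q" "\<omega>' \<in> Q" "\<omega> n \<noteq> \<omega>' n"
      unfolding n_def by blast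
    have agree: "\<omega>'' k = \<omega> k" if "\<omega>'' \<in> Q" "k < n" for \<omega>'' k
      using not_less_Least[OF that(2)[unfolded n_def]] that(1) o(1) by blast
    have "exp (- birkhoff_sum \<omega> (Suc n)) \<le> dist (coded_point \<omega>) (coded_point \<omega>')"
      using coded_point_separated[of n \<omega>' \<omega>] agree[OF o(2)] o(3) by (simp add: dist_real_def)
    also have "\<dots> \<le> diameter U" by (intro diameter_bounded_bound U QU o)
    finally have d: "exp (- birkhoff_sum \<omega> (Suc n)) \<le> diameter U" .
    have g: "ennreal (exp (- s * birkhoff_sum \<omega> (Suc n))) \<le> hausdorff_gauge s U"
    proof -
      have "exp (- s * birkhoff_sum \<omega> (Suc n)) = exp (- birkhoff_sum \<omega> (Suc n)) powr s" by (simp add: powr_def)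
      also have "\<dots> \<le> diameter U powr s" by (rule powr_mono2) (use s d in auto)
      finally show ?thesis using QU[OF o(1)] unfolding hausdorff_gauge_def by (auto intro: ennreal_leI)
    qed
    show ?thesis
    proof (intro bexI conjI)
      show "Q \<subseteq> word_cylinder (first_letters \<omega> n)" using agree by (auto simp: mem_word_cylinder_first_letters)
      have "emeasure (bernoulli t) (word_cylinder (first_letters \<omega> n)) \<le> ennreal (C * exp (- s * birkhoff_sum \<omega> (Suc n)))"
        unfolding emeasure_word_cylinder[OF t] by (intro ennreal_leI Q o)
      also have "\<dots> = ennreal C * ennreal (exp (- s * birkhoff_sum \<omega> (Suc n)))" using C by (simp add: ennreal_mult)
      also have "\<dots> \<le> ennreal C * hausdorff_gauge s U" by (intro mult_left_mono g) simp
      finally show "emeasure (bernoulli t) (word_cylinder (first_letters \<omega> n)) \<le> ennreal C * hausdorff_gauge s U" .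
    qed (rule sets_word_cylinder)
  next
    case False
    show ?thesis
    proof (cases "Q = {}")
      case True
      then show ?thesis by (intro bexI[of _ "{}"]) auto
    next
      case ne: False
      then obtain \<omega> where o: "\<omega> \<in> Q" by blast
      define V where "V = (\<Inter>n. word_cylinder (first_letters \<omega> n))"
      have V: "V \<in> sets (bernoulli t)" unfolding V_def by (intro sets.countable_INT) (auto simp: sets_word_cylinder)
      have QV: "Q \<subseteq> V" using False o by (auto simp: V_def mem_word_cylinder_first_letters)
      define q where "q = exp (- t * lam 0 - pressure t)"
      have q: "0 < q" "q < 1" using pressure_gt[OF t, of 0] by (auto simp: q_def mult.commute)
      have "measure (bernoulli t) V \<le> q ^ n" for n
      proof -
        have "emeasure (bernoulli t) V \<le> emeasure (bernoulli t) (word_cylinder (first_letters \<omega> n))"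
          by (intro emeasure_mono sets_word_cylinder) (auto simp: V_def)
        also have "\<dots> \<le> ennreal (q ^ n)"
          unfolding emeasure_word_cylinder[OF t] q_def by (intro ennreal_leI gibbs_weight_first_letters_le[OF t])
        finally show ?thesis using q by (simp add: M.emeasure_eq_measure)
      qed
      then have "measure (bernoulli t) V \<le> 0"
        by (intro LIMSEQ_le_const[OF LIMSEQ_power_zero[of q]]) (use q in auto)
      then have "emeasure (bernoulli t) V = 0" by (simp add: M.emeasure_eq_measure measure_le_0_iff)
      then show ?thesis using V QV by (intro bexI[of _ V]) auto
    qed
  qed
qed

text \<open>If \<open>birkhoff_sum \<omega> n / n\<close> converges to \<open>a = mean_exponent t\<close>, then so does \<open>birkhoff_sum \<omega> (n + 1) / n\<close>,
and hence \<open>gibbs_weight t\<close> of the first \<open>n\<close> letters is eventually smaller than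
\<open>exp (- s * birkhoff_sum \<omega> (n + 1))\<close>, as \<open>s * a < t * a + pressure t\<close>. With a suitable constant \<open>C\<close> the
estimate holds for all \<open>n\<close> on a set of positive measure, to which \<open>mass_of_set\<close> applies.\<close>
lemma hausdorff_measure_level_set_pos:
  assumes t: "0 < t" and s: "0 \<le> s" and gap: "(s - t) * mean_exponent t < pressure t"
  shows "hausdorff_measure s (level_set (mean_exponent t)) \<noteq> 0"
proof -
  interpret M: prob_space "bernoulli t" by (rule prob_space_bernoulli)
  define G where "G C = {\<omega>. \<forall>n. gibbs_weight t (first_letters \<omega> n) \<le> real C * exp (- s * birkhoff_sum \<omega> (Suc n))}" for C :: nat
  have G_sets: "G C \<in> sets (bernoulli t)" for C
  proof -
    have "{\<omega>. gibbs_weight t (first_letters \<omega> n) \<le> real C * exp (- s * birkhoff_sum \<omega> (Suc n))} \<in> sets (bernoulli t)" for n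
    proof -
      have "take n (first_letters \<omega> (Suc n)) = first_letters \<omega> n" for \<omega> by (simp add: first_letters_def take_map)
      then show ?thesis
        using sets_prefix_event[of "\<lambda>w. gibbs_weight t (take n w) \<le> real C * exp (- s * word_sum w)" "Suc n" t]
        by (simp add: word_sum_first_letters)
    qed
    then have "(\<Inter>n. {\<omega>. gibbs_weight t (first_letters \<omega> n) \<le> real C * exp (- s * birkhoff_sum \<omega> (Suc n))}) \<in> sets (bernoulli t)"
      by (intro sets.countable_INT) auto
    moreover have "(\<Inter>n. {\<omega>. gibbs_weight t (first_letters \<omega> n) \<le> real C * exp (- s * birkhoff_sum \<omega> (Suc n))}) = G C"
      by (auto simp: G_def)
    ultimately show ?thesis by simp
  qed
  have in_G: "\<exists>C. \<omega> \<in> G C" if lim: "(\<lambda>n. birkhoff_sum \<omega> n / real n) \<longlonglongrightarrow> mean_exponent t" for \<omega>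
  proof -
    have "(\<lambda>n. birkhoff_sum \<omega> (Suc n) / real (Suc n) * (real (Suc n) / real n)) \<longlonglongrightarrow> mean_exponent t * 1"
      by (intro tendsto_mult LIMSEQ_Suc[OF lim] LIMSEQ_Suc_n_over_n)
    then have "(\<lambda>n. birkhoff_sum \<omega> (Suc n) / real n) \<longlonglongrightarrow> mean_exponent t" by simp
    then have "(\<lambda>n. - t * (birkhoff_sum \<omega> n / real n) - pressure t + s * (birkhoff_sum \<omega> (Suc n) / real n))
        \<longlonglongrightarrow> - t * mean_exponent t - pressure t + s * mean_exponent t" by (intro tendsto_intros lim)
    moreover have "- t * mean_exponent t - pressure t + s * mean_exponent t < 0" using gap by (simp add: algebra_simps)
    ultimately have "\<forall>\<^sub>F n in sequentially. - t * (birkhoff_sum \<omega> n / real n) - pressure t + s * (birkhoff_sum \<omega> (Suc n) / real n) < 0"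
      by (rule order_tendstoD)
    then obtain N where N: "\<And>n. N \<le> n \<Longrightarrow> - t * (birkhoff_sum \<omega> n / real n) - pressure t + s * (birkhoff_sum \<omega> (Suc n) / real n) < 0"
      by (auto simp: eventually_sequentially)
    let ?r = "\<lambda>n. gibbs_weight t (first_letters \<omega> n) * exp (s * birkhoff_sum \<omega> (Suc n))"
    have r_le: "?r n \<le> 1" if "n \<ge> Suc N" for n
    proof -
      have "- t * birkhoff_sum \<omega> n - real n * pressure t + s * birkhoff_sum \<omega> (Suc n) < 0"
        using N[of n] that by (simp add: field_simps)
      then show ?thesis by (simp add: gibbs_weight_def word_sum_first_letters mult_exp_exp)
    qed
    obtain C :: nat where C: "1 + (\<Sum>n\<le>N. ?r n) \<le> real C" using real_arch_simple by blast
    have r0: "0 \<le> ?r n" for n by (simp add: gibbs_weight_def)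
    have "?r n \<le> real C" for n
    proof (cases "n \<le> N")
      case True
      then have "?r n \<le> (\<Sum>n\<le>N. ?r n)" by (intro member_le_sum r0) auto
      then show ?thesis using C by simp
    next
      case False
      then have "?r n \<le> 1" by (intro r_le) simp
      also have "\<dots> \<le> real C" using C sum_nonneg[of "{..N}" ?r] r0 by fastforce
      finally show ?thesis .
    qed
    then have "gibbs_weight t (first_letters \<omega> n) \<le> real C * exp (- s * birkhoff_sum \<omega> (Suc n))" for n
      by (simp add: exp_minus field_simps)
    then have "\<omega> \<in> G C" by (simp add: G_def)
    then show ?thesis ..
  qed
  have AE_lim: "AE \<omega> in bernoulli t. (\<lambda>n. birkhoff_sum \<omega> n / real n) \<longlonglongrightarrow> mean_exponent t" by (rule AE_birkhoff[OF t])
  obtain C where C: "emeasure (bernoulli t) (G C) \<noteq> 0"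
  proof (rule ccontr)
    assume "\<not> thesis"
    then have "\<And>C. emeasure (bernoulli t) (G C) = 0" using that by blast
    then have "emeasure (bernoulli t) (\<Union>C. G C) = 0" by (intro emeasure_UN_eq_0) (use G_sets in auto)
    moreover have "emeasure (bernoulli t) (space (bernoulli t)) \<le> emeasure (bernoulli t) (\<Union>C. G C)"
      by (rule emeasure_mono_AE) (use AE_lim in_G G_sets in \<open>auto elim!: eventually_mono\<close>)
    ultimately show False using M.emeasure_space_1 by simp
  qed
  have C0: "0 < C"
  proof (rule ccontr)
    assume "\<not> 0 < C"
    then have "G C = {}" by (auto simp: G_def gibbs_weight_def not_le)
    then show False using C by simp
  qed
  define m where "m = emeasure (bernoulli t) (G C) / ennreal (real C)"
  have "0 < emeasure (bernoulli t) (G C)" using C by (metis not_gr_zero)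
  then have m: "0 < m" unfolding m_def by (simp add: ennreal_zero_less_divide)
  have "m \<le> hausdorff_premeasure s 1 (level_set (mean_exponent t))"
    unfolding hausdorff_premeasure_def
  proof (rule INF_greatest)
    fix U :: "nat \<Rightarrow> real set"
    assume "U \<in> {U. level_set (mean_exponent t) \<subseteq> (\<Union>i. U i) \<and> (\<forall>i. bounded (U i) \<and> diameter (U i) \<le> 1)}"
    then have U: "level_set (mean_exponent t) \<subseteq> (\<Union>i. U i)" "\<And>i. bounded (U i)" by auto
    define Q where "Q i = {\<omega> \<in> G C. coded_point \<omega> \<in> U i}" for i
    have "\<exists>V\<in>sets (bernoulli t). Q i \<subseteq> V \<and> emeasure (bernoulli t) V \<le> ennreal (real C) * hausdorff_gauge s (U i)" for i
      by (rule mass_of_set[OF t s _ U(2)]) (auto simp: Q_def G_def)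
    then obtain V where V: "\<And>i. V i \<in> sets (bernoulli t)" "\<And>i. Q i \<subseteq> V i"
      "\<And>i. emeasure (bernoulli t) (V i) \<le> ennreal (real C) * hausdorff_gauge s (U i)" by metis
    have cov: "\<omega> \<in> (\<Union>i. V i)" if "\<omega> \<in> G C" "(\<lambda>n. birkhoff_sum \<omega> n / real n) \<longlonglongrightarrow> mean_exponent t" for \<omega>
    proof -
      have "coded_point \<omega> \<in> level_set (mean_exponent t)"
        using that(2) by (simp add: level_set_def coded_point_invariant has_lyapunov_exponent_iff itinerary_coded_point)
      then obtain i where "coded_point \<omega> \<in> U i" using U(1) by blast
      then have "\<omega> \<in> Q i" using that(1) by (simp add: Q_def)
      then show ?thesis using V(2) by blast
    qed
    have "emeasure (bernoulli t) (G C) \<le> emeasure (bernoulli t) (\<Union>i. V i)"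
      by (rule emeasure_mono_AE) (use AE_lim cov V(1) in \<open>auto elim!: eventually_mono\<close>)
    also have "\<dots> \<le> (\<Sum>i. emeasure (bernoulli t) (V i))"
      by (rule emeasure_subadditive_countably) (use V in auto)
    also have "\<dots> \<le> (\<Sum>i. ennreal (real C) * hausdorff_gauge s (U i))"
      by (intro suminf_le V(3)) auto
    also have "\<dots> = ennreal (real C) * (\<Sum>i. hausdorff_gauge s (U i))" by (rule ennreal_suminf_cmult)
    finally show "m \<le> (\<Sum>i. hausdorff_gauge s (U i))"
      unfolding m_def by (intro divide_le_posI_ennreal) (use C0 in auto)
  qed
  also have "\<dots> \<le> hausdorff_measure s (level_set (mean_exponent t))"
    unfolding hausdorff_measure_def by (rule SUP_upper) simp
  finally show ?thesis using m by auto
qed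

lemma dim_formula_pos: assumes "lam 0 < a" shows "0 < dim_formula a"
proof -
  have t: "0 < temperature a" using mean_exponent_temperature[OF assms] by simp
  have "temperature a * lam 0 < temperature a * a" using t assms by simp
  then have "0 < temperature a * a + pressure (temperature a)" using pressure_gt[OF t, of 0] by (simp add: mult.commute)
  then show ?thesis using assms lam_pos by (simp add: dim_formula_def field_simps)
qed

lemma hausdorff_dim_level_set:
  assumes a: "lam 0 < a" shows "hausdorff_dim (level_set a) = ennreal (dim_formula a)"
proof (rule antisym)
  have t: "0 < temperature a" "mean_exponent (temperature a) = a" using mean_exponent_temperature[OF a] by auto
  have a0: "0 < a" using a lam_pos by simp
  show "hausdorff_dim (level_set a) \<le> ennreal (dim_formula a)"
  proof (rule ennreal_le_epsilon)
    fix e :: real assume e: "0 < e"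
    have "hausdorff_measure (dim_formula a + e) (level_set a) = 0"
    proof (rule hausdorff_measure_level_set_eq_0[OF t(1)])
      show "pressure (temperature a) < (dim_formula a + e - temperature a) * a"
        using a0 e by (simp add: dim_formula_def field_simps)
    qed (use dim_formula_pos[OF a] e in simp)
    then have "hausdorff_dim (level_set a) \<le> ennreal (dim_formula a + e)"
      unfolding hausdorff_dim_def by (intro INF_lower) (use dim_formula_pos[OF a] e in simp)
    then show "hausdorff_dim (level_set a) \<le> ennreal (dim_formula a) + ennreal e"
      using dim_formula_pos[OF a] e by simp
  qed
  show "ennreal (dim_formula a) \<le> hausdorff_dim (level_set a)"
    unfolding hausdorff_dim_def
  proof (rule INF_greatest)
    fix s assume s: "s \<in> {s. 0 \<le> s \<and> hausdorff_measure s (level_set a) = 0}"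
    have "dim_formula a \<le> s"
    proof (rule ccontr)
      assume "\<not> dim_formula a \<le> s"
      then have "(s - temperature a) * a < pressure (temperature a)" using a0 by (simp add: dim_formula_def field_simps)
      then show False using hausdorff_measure_level_set_pos[OF t(1), of s] s t(2) by auto
    qed
    then show "ennreal (dim_formula a) \<le> ennreal s" by (rule ennreal_leI)
  qed
qed

lemma lyapunov_spectrum_eq: "lam 0 < a \<Longrightarrow> lyapunov_spectrum branch branch_map a = dim_formula a"
  using hausdorff_dim_level_set[of a] dim_formula_pos[of a]
  by (simp add: lyapunov_spectrum_def level_set_def)

lemma interior_lyapunov_values: "interior (lyapunov_values branch branch_map) = {lam 0<..}"
proof -
  have "{lam 0<..} \<subseteq> lyapunov_values branch branch_map"
  proof
    fix a assume "a \<in> {lam 0<..}"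
    then have t: "0 < temperature a" "mean_exponent (temperature a) = a" using mean_exponent_temperature by auto
    interpret M: prob_space "bernoulli (temperature a)" by (rule prob_space_bernoulli)
    obtain \<omega> where "(\<lambda>n. birkhoff_sum \<omega> n / real n) \<longlonglongrightarrow> a"
      using eventually_happens'[OF M.ae_filter_bot AE_birkhoff[OF t(1)]] t(2) by auto
    then show "a \<in> lyapunov_values branch branch_map"
      unfolding lyapunov_values_def using coded_point_invariant[of \<omega>]
      by (auto simp: has_lyapunov_exponent_iff itinerary_coded_point intro!: bexI[of _ "coded_point \<omega>"])
  qed
  moreover have "lyapunov_values branch branch_map \<subseteq> {lam 0..}"
  proof
    fix a assume "a \<in> lyapunov_values branch branch_map"
    then obtain x where "x \<in> invariant_set branch branch_map" "has_lyapunov_exponent branch branch_map x a"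
      by (auto simp: lyapunov_values_def)
    then have lim: "(\<lambda>n. birkhoff_sum (itinerary x) n / real n) \<longlonglongrightarrow> a" using has_lyapunov_exponent_iff by blast
    have "lam 0 \<le> a"
    proof (rule LIMSEQ_le_const[OF lim], intro exI allI impI)
      fix n :: nat assume "1 \<le> n"
      then show "lam 0 \<le> birkhoff_sum (itinerary x) n / real n" using birkhoff_sum_lower[of n "itinerary x"] by (simp add: field_simps)
    qed
    then show "a \<in> {lam 0..}" by simp
  qed
  ultimately show ?thesis
    by (metis interior_maximal interior_mono interior_real_atLeast open_greaterThan subset_antisym)
qed

theorem inflection_points_branch:
  "inflection_points (lyapunov_values branch branch_map) (lyapunov_spectrum branch branch_map)
    = mean_exponent ` {t. 0 < t \<and> inflection_fun t = 0}"
  by (rule inflection_points_eq[OF interior_lyapunov_values lyapunov_spectrum_eq])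

end

section \<open>A lacunary choice of lengths\<close>

text \<open>The branches come in blocks: the branches \<open>i < card_upto k\<close> make up the blocks \<open>0, \<dots>, k\<close>, and
\<open>lacunary\<close> is constant on each block. For \<open>t\<close> of the order of \<open>10 powr (- k)\<close> block \<open>k\<close> dominates the partition
function: the earlier blocks have too few branches, because \<open>log_card\<close> grows by the factor \<open>20\<close> from one block to
the next, and the branches of the later blocks are too short, because the ratio of \<open>lacunary\<close> to \<open>log_card\<close>
grows by the factor \<open>10\<close>.\<close>

definition card_upto :: "nat \<Rightarrow> nat" where "card_upto k = 2 ^ (20 ^ k)"

definition block :: "nat \<Rightarrow> nat" where "block i = (LEAST k. i < card_upto k)"

definition log_card :: "nat \<Rightarrow> real" where "log_card k = 20 ^ k * ln 2"

definition lacunary :: "nat \<Rightarrow> real" where "lacunary i = 5 * 10 ^ block i * log_card (block i)"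

lemma card_upto_mono: "j \<le> k \<Longrightarrow> card_upto j \<le> card_upto k"
  unfolding card_upto_def by (intro power_increasing) auto

lemma less_block: "i < card_upto (block i)"
proof -
  have "i < 20 ^ i" by (rule power_gt_expt) simp
  also have "(20::nat) ^ i < 2 ^ (20 ^ i)" by (rule power_gt_expt) simp
  finally have "i < card_upto i" unfolding card_upto_def .
  then show ?thesis unfolding block_def by (rule LeastI)
qed

lemma block_le: "i < card_upto k \<Longrightarrow> block i \<le> k"
  unfolding block_def by (rule Least_le)

lemma block_gt: "card_upto k \<le> i \<Longrightarrow> k < block i"
  using less_block[of i] card_upto_mono[of "block i" k] by linarith

lemma exp_log_card: "exp (log_card k) = real (card_upto k)"
proof -
  have "exp (log_card k) = exp (real (20 ^ k) * ln 2)" by (simp add: log_card_def)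
  also have "\<dots> = exp (ln 2) ^ (20 ^ k)" by (rule exp_of_nat_mult)
  finally show ?thesis by (simp add: card_upto_def)
qed

lemma ln_Suc_le_log_card: "ln (real (Suc i)) \<le> log_card (block i)"
proof -
  have "real (Suc i) \<le> exp (log_card (block i))"
    unfolding exp_log_card of_nat_le_iff using less_block[of i] by (rule Suc_leI)
  then have "ln (real (Suc i)) \<le> ln (exp (log_card (block i)))" by (subst ln_le_cancel_iff) auto
  then show ?thesis by simp
qed

lemma log_card_ge: "ln 2 \<le> log_card k" by (simp add: log_card_def)

lemma log_card_pos: "0 < log_card k" by (simp add: log_card_def)

lemma lacunary_mono: "block i \<le> k \<Longrightarrow> lacunary i \<le> 5 * 10 ^ k * log_card k"
  unfolding lacunary_def log_card_def by (intro mult_mono power_increasing) auto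

text \<open>For these \<open>t\<close> the exponent of a later block \<open>j\<close> satisfies \<open>t * lacunary i \<ge> 2 * log_card j\<close>, which beats the
number of branches in that block: the later blocks contribute a bounded amount.\<close>
lemma lacunary_tail:
  assumes "card_upto k \<le> i" "1 / (25 * 10 ^ k) \<le> t"
  shows "exp (- t * lacunary i) \<le> 1 / (real (Suc i))\<^sup>2"
proof -
  let ?j = "block i"
  have "Suc k \<le> ?j" using block_gt[OF assms(1)] by simp
  then have "(10::real) ^ Suc k \<le> 10 ^ ?j" by (rule power_increasing) simp
  then have "1 / (25 * 10 ^ k) * (5 * 10 ^ Suc k) \<le> 1 / (25 * 10 ^ k) * (5 * 10 ^ ?j :: real)"
    by (intro mult_left_mono) auto
  then have "2 \<le> 1 / (25 * 10 ^ k) * (5 * 10 ^ ?j :: real)" by simp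
  also have "\<dots> \<le> t * (5 * 10 ^ ?j)" by (rule mult_right_mono[OF assms(2)]) simp
  finally have "2 * log_card ?j \<le> t * (5 * 10 ^ ?j) * log_card ?j"
    by (rule mult_right_mono) (simp add: log_card_pos less_imp_le)
  then have "2 * ln (real (Suc i)) \<le> t * lacunary i"
    using ln_Suc_le_log_card[of i] by (simp add: lacunary_def mult.assoc)
  then have "exp (- t * lacunary i) \<le> exp (- (2 * ln (real (Suc i))))" by simp
  also have "\<dots> = 1 / (real (Suc i))\<^sup>2"
    by (simp add: exp_minus exp_double field_simps del: of_nat_Suc)
  finally show ?thesis .
qed

lemma summable_inverse_Suc_squares: "summable (\<lambda>i. 1 / (real (Suc i))\<^sup>2)"
  using inverse_squares_sums by (auto simp: sums_iff)

lemma suminf_inverse_Suc_squares: "(\<Sum>i. 1 / (real (Suc i))\<^sup>2) \<le> 2"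
proof -
  have "(\<Sum>i. 1 / (real (Suc i))\<^sup>2) = pi\<^sup>2 / 6" using inverse_squares_sums by (simp add: sums_iff add.commute)
  also have "pi\<^sup>2 \<le> 3.2\<^sup>2" by (intro power_mono) (use pi_approx in auto)
  finally show ?thesis by (simp add: power2_eq_square)
qed

text \<open>The factor \<open>5\<close> in \<open>lacunary\<close> pays for both requirements on the total length: \<open>2\<close> for
convergence like \<open>1 / (i + 1)\<^sup>2\<close>, and the remaining \<open>3 * ln 2\<close> for a factor \<open>1 / 8\<close>, which brings the sum
below \<open>1 / 3\<close>.\<close>
interpretation lac: gap_system lacunary
proof
  show "lacunary 0 \<le> lacunary i" for i
  proof -
    have "block 0 \<le> 0" by (rule block_le) (simp add: card_upto_def)
    then show ?thesis unfolding lacunary_def log_card_def by (intro mult_mono power_increasing) auto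
  qed
  show "0 < lacunary 0" by (simp add: lacunary_def log_card_pos)
  show "summable (\<lambda>i. exp (- t * lacunary i))" if t: "0 < t" for t
  proof -
    obtain k where k: "1 / (25 * t) < 10 ^ k" using real_arch_pow[of 10 "1 / (25 * t)"] by auto
    then have "1 / (25 * 10 ^ k) \<le> t" using t by (simp add: field_simps)
    then show ?thesis
      by (intro summable_comparison_test'[OF summable_inverse_Suc_squares, of "card_upto k"])
         (use lacunary_tail in auto)
  qed
  show "(\<Sum>i. exp (- lacunary i)) \<le> 1 / 3"
  proof -
    have le: "exp (- lacunary i) \<le> 1 / 8 * (1 / (real (Suc i))\<^sup>2)" for i
    proof -
      have "5 * log_card (block i) * 1 \<le> 5 * log_card (block i) * 10 ^ block i"
        by (intro mult_left_mono) (auto simp: log_card_pos less_imp_le)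
      also have "\<dots> = lacunary i" by (simp add: lacunary_def)
      finally have "3 * ln 2 + 2 * ln (real (Suc i)) \<le> lacunary i"
        using log_card_ge[of "block i"] ln_Suc_le_log_card[of i] by linarith
      then have "exp (- lacunary i) \<le> exp (- (real 3 * ln 2) - 2 * ln (real (Suc i)))" by simp
      also have "\<dots> = 1 / 8 * (1 / (real (Suc i))\<^sup>2)"
        unfolding exp_diff exp_minus exp_of_nat_mult exp_double by (simp add: field_simps del: of_nat_Suc)
      finally show ?thesis .
    qed
    have s: "summable (\<lambda>i. 1 / 8 * (1 / (real (Suc i))\<^sup>2))"
      by (intro summable_mult summable_inverse_Suc_squares)
    have "(\<Sum>i. exp (- lacunary i)) \<le> (\<Sum>i. 1 / 8 * (1 / (real (Suc i))\<^sup>2))"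
      by (rule suminf_le[OF le _ s]) (rule summable_comparison_test'[OF s], use le in simp)
    also have "\<dots> = 1 / 8 * (\<Sum>i. 1 / (real (Suc i))\<^sup>2)"
      by (rule suminf_mult[OF summable_inverse_Suc_squares])
    finally show ?thesis using suminf_inverse_Suc_squares by simp
  qed
qed

text \<open>The partition function splits into the blocks up to \<open>k\<close>, where each term is at most \<open>1\<close>, block \<open>k + 1\<close>, and
the bounded tail. Each of the three is at most \<open>exp y\<close>, and \<open>3 * exp y \<le> exp (y + 2 * ln 2)\<close>.\<close>
lemma pressure_upper:
  assumes t: "1 / (25 * 10 ^ Suc k) \<le> t" and y: "log_card k \<le> y" "ln 2 \<le> y"
    "log_card (Suc k) - 5 * 10 ^ Suc k * log_card (Suc k) * t \<le> y"
  shows "lac.pressure t \<le> y + 2 * ln 2"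
proof -
  have t0: "0 < t" by (rule less_le_trans[OF _ t]) simp
  let ?N = "card_upto k" and ?N' = "card_upto (Suc k)"
  let ?f = "\<lambda>i. exp (- lacunary i * t)"
  have NN: "?N \<le> ?N'" by (rule card_upto_mono) simp
  have s: "summable ?f" "lac.dirichlet 0 t = suminf ?f" using lac.exp_sums_dirichlet[OF t0] by (simp_all add: sums_iff)
  have "suminf ?f = (\<Sum>i. ?f (i + ?N')) + (\<Sum>i<?N'. ?f i)" by (rule suminf_split_initial_segment[OF s(1)])
  also have "(\<Sum>i<?N'. ?f i) = (\<Sum>i<?N. ?f i) + (\<Sum>i=?N..<?N'. ?f i)"
    using sum.atLeastLessThan_concat[OF _ NN, of 0 ?f] by (simp add: atLeast0LessThan)
  also have "(\<Sum>i<?N. ?f i) \<le> (\<Sum>i<?N. 1)"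
    by (intro sum_mono) (use t0 lac.lam_gt0 in \<open>simp add: less_imp_le\<close>)
  also have "(\<Sum>i<?N. 1) = exp (log_card k)" by (simp add: exp_log_card)
  also have "exp (log_card k) \<le> exp y" using y(1) by simp
  also have "(\<Sum>i=?N..<?N'. ?f i) \<le> (\<Sum>i=?N..<?N'. exp (- (5 * 10 ^ Suc k * log_card (Suc k)) * t))"
  proof (intro sum_mono)
    fix i assume "i \<in> {?N..<?N'}"
    then have "block i = Suc k" using block_gt[of k i] block_le[of i "Suc k"] by auto
    then show "?f i \<le> exp (- (5 * 10 ^ Suc k * log_card (Suc k)) * t)" by (simp add: lacunary_def)
  qed
  also have "\<dots> \<le> real ?N' * exp (- (5 * 10 ^ Suc k * log_card (Suc k)) * t)" by simp
  also have "\<dots> = exp (log_card (Suc k) - 5 * 10 ^ Suc k * log_card (Suc k) * t)"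
    by (simp add: exp_diff exp_log_card exp_minus field_simps)
  also have "\<dots> \<le> exp y" using y(3) by simp
  also have "(\<Sum>i. ?f (i + ?N')) \<le> exp y"
  proof -
    have "(\<Sum>i. ?f (i + ?N')) \<le> (\<Sum>i. 1 / (real (Suc (i + ?N')))\<^sup>2)"
    proof (rule suminf_le)
      show "?f (i + ?N') \<le> 1 / (real (Suc (i + ?N')))\<^sup>2" for i
        using lacunary_tail[of "Suc k" "i + ?N'" t] t by (simp add: mult.commute)
    qed (use summable_ignore_initial_segment[OF s(1)] summable_ignore_initial_segment[OF summable_inverse_Suc_squares] in simp_all)
    also have "\<dots> \<le> (\<Sum>i. 1 / (real (Suc (i + ?N')))\<^sup>2) + (\<Sum>i<?N'. 1 / (real (Suc i))\<^sup>2)"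
      by (simp add: sum_nonneg)
    also have "\<dots> = (\<Sum>i. 1 / (real (Suc i))\<^sup>2)"
      by (rule suminf_split_initial_segment[OF summable_inverse_Suc_squares, symmetric])
    also have "\<dots> \<le> 2" by (rule suminf_inverse_Suc_squares)
    also have "2 = exp (ln (2::real))" by simp
    also have "\<dots> \<le> exp y" using y(2) by (rule exp_le_cancel_iff[THEN iffD2])
    finally show ?thesis .
  qed
  finally have "exp (lac.pressure t) \<le> 3 * exp y"
    unfolding lac.exp_pressure[OF t0] s(2) by simp
  also have "\<dots> \<le> 4 * exp y" by simp
  also have "4 * exp y = exp (y + 2 * ln 2)"
    by (simp add: exp_add exp_double)
  finally show ?thesis by simp
qed

lemma pressure_block_lower:
  assumes t: "0 < t" shows "log_card k - 5 * 10 ^ k * log_card k * t \<le> lac.pressure t"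
proof -
  let ?N = "card_upto k"
  have "exp (log_card k - 5 * 10 ^ k * log_card k * t) = (\<Sum>i<?N. exp (- (5 * 10 ^ k * log_card k) * t))"
    by (simp add: exp_diff exp_log_card exp_minus field_simps)
  also have "\<dots> \<le> (\<Sum>i<?N. exp (- lacunary i * t))"
  proof (rule sum_mono)
    fix i assume "i \<in> {..<?N}"
    then have "lacunary i * t \<le> 5 * 10 ^ k * log_card k * t"
      using lacunary_mono[OF block_le] t by (intro mult_right_mono) auto
    then show "exp (- (5 * 10 ^ k * log_card k) * t) \<le> exp (- lacunary i * t)" by simp
  qed
  also have "\<dots> \<le> exp (lac.pressure t)" unfolding lac.exp_pressure[OF t] by (rule lac.dirichlet_ge_sum[OF t]) simp
  finally show ?thesis by simp
qed

text \<open>In terms of \<open>n = log_card (k + 1)\<close> the affine function \<open>n - 5 * 10 ^ (k + 1) * n * t\<close> takes the values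
\<open>4 * n / 5\<close>, \<open>n / 5\<close> and \<open>n / 2\<close> at \<open>a\<close>, \<open>b\<close> and their midpoint. The pressure exceeds the first two by at
most \<open>2 * ln 2\<close>, a small fraction of \<open>n\<close>, and is at least the third. The square roots of the three
values are then at most \<open>0.9\<close>, at most \<open>0.46\<close> and at least \<open>0.7\<close> times \<open>sqrt n\<close>, and
\<open>0.9 + 0.46 < 2 * 0.7\<close>.\<close>
lemma sqrt_pressure_kink:
  assumes "0 < d"
  shows "\<exists>a b. 0 < a \<and> a < b \<and> b < d \<and>
    sqrt (lac.pressure a) + sqrt (lac.pressure b) < 2 * sqrt (lac.pressure ((a + b) / 2))"
proof -
  obtain j where j: "1 / d < 10 ^ j" using real_arch_pow[of 10 "1 / d"] by auto
  \<comment> \<open>The shift makes \<open>log_card (Suc k)\<close> at least \<open>400 * ln 2\<close>.\<close>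
  define k where "k = Suc j"
  define r :: real where "r = 10 ^ Suc k"
  define n where "n = log_card (Suc k)"
  define a where "a = 1 / (25 * r)"
  define b where "b = 4 / (25 * r)"
  have "(10::real) ^ j \<le> r" unfolding r_def k_def by (intro power_increasing) auto
  then have r: "0 < r" "1 / d < r" using j by (auto simp: r_def)
  have ab: "0 < a" "a < b" "b < d" "(a + b) / 2 = 1 / (10 * r)"
    using r assms by (auto simp: a_def b_def field_simps)
  have nk: "n = 20 * log_card k" by (simp add: n_def log_card_def)
  have "(20::real) ^ 2 \<le> 20 ^ Suc k" unfolding k_def by (intro power_increasing) auto
  then have "400 * ln 2 \<le> n" unfolding n_def log_card_def by (intro mult_right_mono) auto
  moreover have "0 < ln (2::real)" by simp
  ultimately have small: "2 * ln 2 \<le> n / 100" "ln 2 \<le> n / 5" "0 < n" by linarith+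
  have "lac.pressure a \<le> 4 * n / 5 + 2 * ln 2"
  proof (rule pressure_upper[of k])
    show "1 / (25 * 10 ^ Suc k) \<le> a" by (simp add: a_def r_def)
    show "log_card (Suc k) - 5 * 10 ^ Suc k * log_card (Suc k) * a \<le> 4 * n / 5"
      unfolding n_def[symmetric] r_def[symmetric] a_def using r by (simp add: field_simps)
  qed (use small nk in simp_all)
  then have pa: "lac.pressure a \<le> 0.81 * n" using small by simp
  have "lac.pressure b \<le> n / 5 + 2 * ln 2"
  proof (rule pressure_upper[of k])
    show "1 / (25 * 10 ^ Suc k) \<le> b" by (simp add: b_def r_def field_simps)
    show "log_card (Suc k) - 5 * 10 ^ Suc k * log_card (Suc k) * b \<le> n / 5"
      unfolding n_def[symmetric] r_def[symmetric] b_def using r by (simp add: field_simps)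
  qed (use small nk in simp_all)
  then have pb: "lac.pressure b \<le> 0.2116 * n" using small by simp
  have "log_card (Suc k) - 5 * 10 ^ Suc k * log_card (Suc k) * ((a + b) / 2) \<le> lac.pressure ((a + b) / 2)"
    by (rule pressure_block_lower) (unfold ab(4), use r in simp)
  then have pm: "0.49 * n \<le> lac.pressure ((a + b) / 2)"
    unfolding n_def[symmetric] r_def[symmetric] ab(4) using r small(3) by (simp add: field_simps)
  \<comment> \<open>\<open>0.9\<^sup>2 = 0.81\<close>, \<open>0.46\<^sup>2 = 0.2116\<close> and \<open>0.7\<^sup>2 = 0.49\<close>\<close>
  have sq: "sqrt (c\<^sup>2 * n) = c * sqrt n" if "0 \<le> c" for c
    using that by (simp add: real_sqrt_mult)
  have "sqrt (lac.pressure a) \<le> sqrt ((9 / 10)\<^sup>2 * n)"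
    using pa by (intro real_sqrt_le_mono) (simp add: power2_eq_square)
  also have "\<dots> = 9 / 10 * sqrt n" by (rule sq) simp
  finally have a9: "sqrt (lac.pressure a) \<le> 9 / 10 * sqrt n" .
  have "sqrt (lac.pressure b) \<le> sqrt ((23 / 50)\<^sup>2 * n)"
    using pb by (intro real_sqrt_le_mono) (simp add: power2_eq_square)
  also have "\<dots> = 23 / 50 * sqrt n" by (rule sq) simp
  finally have b46: "sqrt (lac.pressure b) \<le> 23 / 50 * sqrt n" .
  have "7 / 10 * sqrt n = sqrt ((7 / 10)\<^sup>2 * n)" by (rule sq[symmetric]) simp
  also have "\<dots> \<le> sqrt (lac.pressure ((a + b) / 2))"
    using pm by (intro real_sqrt_le_mono) (simp add: power2_eq_square)
  finally have "sqrt (lac.pressure a) + sqrt (lac.pressure b) < 2 * sqrt (lac.pressure ((a + b) / 2))"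
    using a9 b46 real_sqrt_gt_zero[OF small(3)] by linarith
  then show ?thesis using ab by blast
qed

theorem theorem1p6:
  shows "\<exists>(B :: nat \<Rightarrow> real set) (T :: real \<Rightarrow> real).
    infinite_branch_pl_map B T \<and>
    countable (inflection_points (lyapunov_values B T) (lyapunov_spectrum B T)) \<and>
    infinite (inflection_points (lyapunov_values B T) (lyapunov_spectrum B T))"
proof (intro exI conjI)
  let ?Z = "{t. 0 < t \<and> lac.inflection_fun t = 0}"
  show "infinite_branch_pl_map lac.branch lac.branch_map" by (rule lac.infinite_branch_pl_map_branch_map)
  have Z: "infinite ?Z" "countable ?Z"
    using lac.infinite_inflection_fun_zeros[OF sqrt_pressure_kink] lac.countable_inflection_fun_zeros by blast+
  show "countable (inflection_points (lyapunov_values lac.branch lac.branch_map) (lyapunov_spectrum lac.branch lac.branch_map))"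
    unfolding lac.inflection_points_branch by (rule countable_image[OF Z(2)])
  have "inj_on lac.mean_exponent ?Z" by (rule inj_onI) (auto intro: lac.mean_exponent_inj)
  then show "infinite (inflection_points (lyapunov_values lac.branch lac.branch_map) (lyapunov_spectrum lac.branch lac.branch_map))"
    unfolding lac.inflection_points_branch using Z(1) by (simp add: finite_image_iff)
qed

end
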